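(* Let $M$ be a homogeneous and unbounded metric space. Suppose that there is $C\in[1,\infty)$ such that all closed balls in $M$ are weak$^*$ $C$-Lipschitz extendable in $M$. Then $\mathcal{F}(M)$ is linearly isomorphic to its countable $\ell_1$-sum $\left(\bigoplus_{\mathbb{N}}\mathcal{F}(M)\right)_1$.
   Context: All scalars are real. A metric space $M$ is homogeneous if for any $x,y\in M$ there is a bijective isometry $\varphi:M\to M$ with $\varphi(x)=y$. Closed balls are the sets $B(x,r)=\{y\in M:d(x,y)\leq r\}$ with $x\in M$, $r>0$. For a metric space $M$ with a chosen base point $0\in M$, $\mathrm{Lip}(M)$ is the space of Lipschitz functions $f:M\to\mathbb{R}$, $\|f\|_L$ is the best Lipschitz constant of $f$, and $\mathrm{Lip}_0(M)=\{f\in\mathrm{Lip}(M): f(0)=0\}$ is a Banach space with norm $\|\cdot\|_L$. The Lipschitz-free space is $\mathcal{F}(M)=\overline{\mathrm{span}}\{\delta(x):x\in M\}\subset \mathrm{Lip}_0(M)^*$, where $\delta(x)(f)=f(x)$. It is an isometric predual of $\mathrm{Lip}_0(M)$, its isometry class does not depend on the base point, and the induced weak$^*$ topology agrees with pointwise convergence on bounded subsets of $\mathrm{Lip}_0(M)$. Let $S\subset M$, with base point $0\in S$. $S$ is weak$^*$ $C$-Lipschitz extendable in $M$ if there is a weak$^*$-to-weak$^*$ continuous (equivalently, pointwise-to-pointwise continuous on bounded sets) linear operator $E:\mathrm{Lip}_0(S)\to\mathrm{Lip}_0(M)$ with $\|E\|\leq C$ and $(Ef)(x)=f(x)$ for all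 $f\in\mathrm{Lip}_0(S)$, $x\in S$. This notion does not depend on the choice of base point. $\left(\bigoplus_{\mathbb{N}}X\right)_1$ denotes the $\ell_1$-sum of countably infinitely many copies of a Banach space $X$. *)

theory Defs
  imports "HOL-Analysis.Analysis" "HOL-Library.Function_Algebras"
begin

text \<open>
  Spaces of functions are subspaces of a full function type with its pointwise vector space
  structure. The norms are real-valued functions that are only meaningful on the subspace in
  question.
\<close>

instantiation "fun" :: (type, real_vector) real_vector
begin

definition scaleR_fun :: "real \<Rightarrow> ('a \<Rightarrow> 'b) \<Rightarrow> 'a \<Rightarrow> 'b"
  where "scaleR_fun c f = (\<lambda>x. c *\<^sub>R f x)"

instance
  by standard (simp_all add: scaleR_fun_def fun_eq_iff scaleR_add_right scaleR_add_left)

end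

lemma scaleR_fun_apply [simp]: "(c *\<^sub>R f) x = c *\<^sub>R f x"
  by (simp add: scaleR_fun_def)


definition linear_on :: "'v::real_vector set \<Rightarrow> ('v \<Rightarrow> 'w::real_vector) \<Rightarrow> bool"
  where "linear_on V T \<longleftrightarrow>
    (\<forall>u\<in>V. \<forall>v\<in>V. T (u + v) = T u + T v) \<and> (\<forall>c. \<forall>v\<in>V. T (c *\<^sub>R v) = c *\<^sub>R T v)"

text \<open>
  A functional on \<open>V\<close> is represented by its extension by \<open>0\<close> outside \<open>V\<close>, so that equality of
  functionals is equality of HOL functions.
\<close>

definition dual_space :: "'v::real_vector set \<Rightarrow> ('v \<Rightarrow> real) \<Rightarrow> ('v \<Rightarrow> real) set"
  where "dual_space V N =
    {\<phi>. linear_on V \<phi> \<and> (\<exists>K. \<forall>v\<in>V. \<bar>\<phi> v\<bar> \<le> K * N v) \<and> (\<forall>v. v \<notin> V \<longrightarrow> \<phi> v = 0)}"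

definition dual_norm :: "'v::real_vector set \<Rightarrow> ('v \<Rightarrow> real) \<Rightarrow> ('v \<Rightarrow> real) \<Rightarrow> real"
  where "dual_norm V N \<phi> = Sup {\<bar>\<phi> v\<bar> |v. v \<in> V \<and> N v \<le> 1}"

definition norm_closure :: "'v::real_vector set \<Rightarrow> ('v \<Rightarrow> real) \<Rightarrow> 'v set \<Rightarrow> 'v set"
  where "norm_closure V N A = {v\<in>V. \<forall>e>0. \<exists>a\<in>A. N (v - a) < e}"

definition l1_sum :: "'v::real_vector set \<Rightarrow> ('v \<Rightarrow> real) \<Rightarrow> (nat \<Rightarrow> 'v) set"
  where "l1_sum V N = {u. (\<forall>n. u n \<in> V) \<and> summable (\<lambda>n. N (u n))}"

definition l1_sum_norm :: "('v \<Rightarrow> real) \<Rightarrow> (nat \<Rightarrow> 'v) \<Rightarrow> real"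
  where "l1_sum_norm N u = (\<Sum>n. N (u n))"

definition linearly_isomorphic ::
  "'v::real_vector set \<Rightarrow> ('v \<Rightarrow> real) \<Rightarrow> 'w::real_vector set \<Rightarrow> ('w \<Rightarrow> real) \<Rightarrow> bool"
  where "linearly_isomorphic V N W N' \<longleftrightarrow>
    (\<exists>T. linear_on V T \<and> bij_betw T V W \<and>
      (\<exists>K. \<forall>v\<in>V. N' (T v) \<le> K * N v) \<and> (\<exists>K. \<forall>v\<in>V. N v \<le> K * N' (T v)))"


definition homogeneous :: "'a::metric_space set \<Rightarrow> bool"
  where "homogeneous M \<longleftrightarrow>
    (\<forall>x\<in>M. \<forall>y\<in>M. \<exists>\<phi>. bij_betw \<phi> M M \<and> (\<forall>u\<in>M. \<forall>v\<in>M. dist (\<phi> u) (\<phi> v) = dist u v) \<and> \<phi> x = y)"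

text \<open>
  For a subset \<open>S\<close> with base point \<open>b \<in> S\<close>, the elements of \<open>lip0 b S\<close> are Lipschitz functions
  on \<open>S\<close> vanishing at \<open>b\<close>, represented by their (in general discontinuous) extension by \<open>0\<close>
  outside \<open>S\<close>.
\<close>

definition lip0 :: "'a::metric_space \<Rightarrow> 'a set \<Rightarrow> ('a \<Rightarrow> real) set"
  where "lip0 b S = {f. (\<exists>L. L-lipschitz_on S f) \<and> f b = 0 \<and> (\<forall>x. x \<notin> S \<longrightarrow> f x = 0)}"

definition lip_norm :: "'a::metric_space set \<Rightarrow> ('a \<Rightarrow> real) \<Rightarrow> real"
  where "lip_norm S f = Inf {L. L-lipschitz_on S f}"

definition delta :: "'a::metric_space \<Rightarrow> 'a set \<Rightarrow> 'a \<Rightarrow> ('a \<Rightarrow> real) \<Rightarrow> real"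
  where "delta b S x = (\<lambda>f. if f \<in> lip0 b S then f x else 0)"

abbreviation free_norm :: "'a::metric_space \<Rightarrow> 'a set \<Rightarrow> (('a \<Rightarrow> real) \<Rightarrow> real) \<Rightarrow> real"
  where "free_norm b S \<equiv> dual_norm (lip0 b S) (lip_norm S)"

definition free_space :: "'a::metric_space \<Rightarrow> 'a set \<Rightarrow> (('a \<Rightarrow> real) \<Rightarrow> real) set"
  where "free_space b S =
    norm_closure (dual_space (lip0 b S) (lip_norm S)) (free_norm b S) (span (delta b S ` S))"

text \<open>
  The weak* topology of \<open>lip0 b S\<close> as the dual of \<open>free_space b S\<close>: the initial topology for the
  evaluations \<open>f \<mapsto> m f\<close> with \<open>m \<in> free_space b S\<close>.
\<close>

definition weak_star :: "'a::metric_space \<Rightarrow> 'a set \<Rightarrow> ('a \<Rightarrow> real) topology"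
  where "weak_star b S =
    pullback_topology (lip0 b S) (\<lambda>f. \<lambda>m\<in>free_space b S. m f)
      (product_topology (\<lambda>_. euclideanreal) (free_space b S))"

text \<open>
  The same base point is used for \<open>S\<close> and for the ambient space \<open>M\<close>. Its choice in \<open>S\<close> is
  immaterial: if \<open>E\<close> is an extension operator for the base point \<open>b\<close>, then
  \<open>f \<mapsto> E (f - f b) + f b\<close> (subtracting the constant on \<open>S\<close> only) is one for any other base
  point, with the same norm.
\<close>

definition weak_star_lip_extendable :: "real \<Rightarrow> 'a::metric_space set \<Rightarrow> 'a set \<Rightarrow> bool"
  where "weak_star_lip_extendable C S M \<longleftrightarrow>
    (\<exists>b\<in>S. \<exists>E. linear_on (lip0 b S) E \<and>
      continuous_map (weak_star b S) (weak_star b M) E \<and>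
      (\<forall>f\<in>lip0 b S. lip_norm M (E f) \<le> C * lip_norm S f) \<and>
      (\<forall>f\<in>lip0 b S. \<forall>x\<in>S. E f x = f x))"

end

theory Submission
  imports Defs
begin

text \<open>
  By a Pelczynski-type swindle it suffices to complement the \<open>\<ell>\<^sub>1\<close>-sum of \<open>X = F(M)\<close> in \<open>X\<close>. A
  partition of unity subordinate to dyadic annuli around the base point (Kalton) decomposes an
  element of \<open>X\<close> into an \<open>\<ell>\<^sub>1\<close>-sequence of elements living on the balls of radius \<open>2 ^ (n + 1)\<close>. As
  \<open>M\<close> is homogeneous and unbounded, every one of these balls has infinitely many isometric copies,
  all of them far apart, and copy number \<open>k\<close> of all the balls is used to embed the \<open>k\<close>-th summand
  of the \<open>\<ell>\<^sub>1\<close>-sum into \<open>X\<close>. The projection is dual to extending Lipschitz functions from the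
  copies to \<open>M\<close>: extend by the given operators, multiply by a cut-off function, and add up the
  disjointly supported results.
\<close>

section \<open>Bounded operators on \<open>\<ell>\<^sub>1\<close>-sums\<close>

text \<open>A bijective isometry carries \<open>M\<close> onto itself, so it cannot move a copy of
  all of \<open>M\<close> away; balls can be moved, which forces the cut into annuli. Dyadic radii
  keep this cut cheap: on the annulus of index \<open>n\<close>, a function vanishing at the base
  point is of order \<open>2 ^ n\<close> at most, which balances the slope \<open>1 / 2 ^ n\<close>
  of the cut-off.

  All operators are built on functions and passed to the free space as adjoints. The obstacle is
  that the adjoint of a bounded operator on \<open>lip0\<close> acts on the whole dual of
  \<open>lip0\<close> and may leave the free space. Weak-star continuity of the extensions prevents
  this: evaluating an extended function at a point is then a finite combination of elements of the
  free space of the ball.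

  Boundedness into the l1-sum becomes, on functions, a bound uniform over bounded sequences. Gluing
  over disjoint balls provides it: two points meet at most two balls, so the Lipschitz constant only
  doubles, however many pieces there are. The final constants are 6C = 2 * 3 * C (gluing, cut-off,
  extension) and 9 = 1 + 8 (partition of unity).\<close>

lemma linear_onD:
  assumes "linear_on V T"
  shows "\<lbrakk>u \<in> V; v \<in> V\<rbrakk> \<Longrightarrow> T (u + v) = T u + T v"
    and "v \<in> V \<Longrightarrow> T (c *\<^sub>R v) = c *\<^sub>R T v"
  using assms by (auto simp: linear_on_def)

lemma linear_on_diff:
  assumes "linear_on V T" "subspace V" "u \<in> V" "v \<in> V"
  shows "T (u - v) = T u - T v"
proof -
  have "T (u + (-1) *\<^sub>R v) = T u + (-1) *\<^sub>R T v"
    using assms by (simp add: linear_onD subspace_mul subspace_neg del: scaleR_minus_left scaleR_minus1_left)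
  then show ?thesis by simp
qed

lemma linear_on_0: "linear_on V T \<Longrightarrow> subspace V \<Longrightarrow> T 0 = 0"
  using linear_on_diff[of V T 0 0] by (simp add: subspace_0)

lemma linear_on_sum:
  assumes "linear_on V T" "subspace V" "\<And>i. i \<in> I \<Longrightarrow> v i \<in> V"
  shows "T (\<Sum>i\<in>I. v i) = (\<Sum>i\<in>I. T (v i))"
  using assms(3)
  by (induction I rule: infinite_finite_induct)
    (simp_all add: linear_on_0[OF assms(1,2)] linear_onD[OF assms(1)] subspace_sum[OF assms(2)])

lemma linear_on_subset: "linear_on V T \<Longrightarrow> U \<subseteq> V \<Longrightarrow> linear_on U T"
  unfolding linear_on_def by blast

lemma sum_fun_apply: "(\<Sum>i\<in>I. f i) x = (\<Sum>i\<in>I. f i x)"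
  by (induction I rule: infinite_finite_induct) auto

text \<open>One interface for \<open>lip0\<close>, its dual, the free space and their l1-sums. An
  inequality suffices as scaling law: positivity follows from
  \<open>v + (-1) *\<^sub>R v = 0\<close>.\<close>

locale seminormed_subspace =
  fixes V :: "'v::real_vector set" and N :: "'v \<Rightarrow> real"
  assumes subspace: "subspace V"
    and triangle: "\<lbrakk>u \<in> V; v \<in> V\<rbrakk> \<Longrightarrow> N (u + v) \<le> N u + N v"
    and scale_le: "v \<in> V \<Longrightarrow> N (c *\<^sub>R v) \<le> \<bar>c\<bar> * N v"
begin

lemmas mem_0 = subspace_0[OF subspace]
  and mem_add = subspace_add[OF subspace]
  and mem_diff = subspace_diff[OF subspace]
  and mem_scale = subspace_scale[OF subspace]
  and mem_sum = subspace_sum[OF subspace]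

lemma norm_0: "N 0 = 0"
  using triangle[of 0 0] scale_le[of 0 0] mem_0 by simp

lemma nonneg: "v \<in> V \<Longrightarrow> 0 \<le> N v"
  using triangle[of v "(-1) *\<^sub>R v"] scale_le[of v "-1"] norm_0 mem_scale[of v "-1"] by simp

lemma norm_minus:
  assumes "v \<in> V" shows "N (- v) = N v"
proof -
  have "- v \<in> V"
    using assms subspace subspace_neg by blast
  then show ?thesis
    using scale_le[of v "-1"] scale_le[of "- v" "-1"] assms by simp
qed

lemma l1_sum_iff: "u \<in> l1_sum V N \<longleftrightarrow> (\<forall>n. u n \<in> V) \<and> summable (\<lambda>n. N (u n))"
  by (simp add: l1_sum_def)

lemma l1_sum_norm_bound:
  assumes "\<And>n. u n \<in> V" "\<And>n. N (u n) \<le> g n" "summable g"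
  shows "u \<in> l1_sum V N" "l1_sum_norm N u \<le> suminf g"
proof -
  have s: "summable (\<lambda>n. N (u n))"
    by (rule summable_comparison_test'[of g 0]) (use assms nonneg in auto)
  then show "u \<in> l1_sum V N" using assms by (simp add: l1_sum_iff)
  show "l1_sum_norm N u \<le> suminf g"
    unfolding l1_sum_norm_def by (rule suminf_le) (use assms s in auto)
qed

lemma seminormed_l1_sum: "seminormed_subspace (l1_sum V N) (l1_sum_norm N)"
proof
  have add: "u + v \<in> l1_sum V N \<and> l1_sum_norm N (u + v) \<le> l1_sum_norm N u + l1_sum_norm N v"
    if "u \<in> l1_sum V N" "v \<in> l1_sum V N" for u v
    using l1_sum_norm_bound[of "u + v" "\<lambda>n. N (u n) + N (v n)"] that
    by (auto simp: l1_sum_iff triangle mem_add l1_sum_norm_def suminf_add summable_add)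
  have scale: "c *\<^sub>R u \<in> l1_sum V N \<and> l1_sum_norm N (c *\<^sub>R u) \<le> \<bar>c\<bar> * l1_sum_norm N u"
    if "u \<in> l1_sum V N" for u c
    using l1_sum_norm_bound[of "c *\<^sub>R u" "\<lambda>n. \<bar>c\<bar> * N (u n)"] that
    by (auto simp: l1_sum_iff scale_le mem_scale l1_sum_norm_def suminf_mult summable_mult)
  have "0 \<in> l1_sum V N" by (simp add: l1_sum_iff mem_0 norm_0)
  with add scale show "subspace (l1_sum V N)" by (auto simp: subspace_def)
  show "l1_sum_norm N (u + v) \<le> l1_sum_norm N u + l1_sum_norm N v"
    if "u \<in> l1_sum V N" "v \<in> l1_sum V N" for u v using add that by blast
  show "l1_sum_norm N (c *\<^sub>R u) \<le> \<bar>c\<bar> * l1_sum_norm N u" if "u \<in> l1_sum V N" for u c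
    using scale that by blast
qed

end

definition bounded_linear_on ::
  "'v::real_vector set \<Rightarrow> ('v \<Rightarrow> real) \<Rightarrow> 'w::real_vector set \<Rightarrow> ('w \<Rightarrow> real) \<Rightarrow> ('v \<Rightarrow> 'w) \<Rightarrow> bool"
  where "bounded_linear_on V N W N' T \<longleftrightarrow>
    linear_on V T \<and> T ` V \<subseteq> W \<and> (\<exists>K\<ge>0. \<forall>v\<in>V. N' (T v) \<le> K * N v)"

lemma bounded_linear_onI:
  assumes "linear_on V T" "\<And>v. v \<in> V \<Longrightarrow> T v \<in> W" "0 \<le> K"
    and "\<And>v. v \<in> V \<Longrightarrow> N' (T v) \<le> K * N v"
  shows "bounded_linear_on V N W N' T"
  using assms unfolding bounded_linear_on_def by blast

lemma bounded_linear_on_linear: "bounded_linear_on V N W N' T \<Longrightarrow> linear_on V T"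
  and bounded_linear_on_mem: "bounded_linear_on V N W N' T \<Longrightarrow> v \<in> V \<Longrightarrow> T v \<in> W"
  unfolding bounded_linear_on_def by blast+

lemma bounded_linear_on_compose:
  assumes S: "bounded_linear_on U M V N S" and T: "bounded_linear_on V N W N' T"
  shows "bounded_linear_on U M W N' (\<lambda>u. T (S u))"
proof -
  obtain K where K: "0 \<le> K" "\<And>u. u \<in> U \<Longrightarrow> N (S u) \<le> K * M u"
    using S unfolding bounded_linear_on_def by blast
  obtain L where L: "0 \<le> L" "\<And>v. v \<in> V \<Longrightarrow> N' (T v) \<le> L * N v"
    using T unfolding bounded_linear_on_def by blast
  have "N' (T (S u)) \<le> (L * K) * M u" if "u \<in> U" for u
    using L(2)[of "S u"] mult_left_mono[OF K(2)[OF that] L(1)] bounded_linear_on_mem[OF S that]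
    by simp
  moreover have "linear_on U (\<lambda>u. T (S u))"
    using linear_onD[OF bounded_linear_on_linear[OF S]] linear_onD[OF bounded_linear_on_linear[OF T]]
      bounded_linear_on_mem[OF S] unfolding linear_on_def by simp
  ultimately show ?thesis
    using K(1) L(1) S T by (intro bounded_linear_onI[of _ _ _ "L * K"]) (auto simp: bounded_linear_on_mem)
qed

lemma bounded_linear_on_add:
  assumes "seminormed_subspace W N'"
    and S: "bounded_linear_on V N W N' S" and T: "bounded_linear_on V N W N' T"
  shows "bounded_linear_on V N W N' (\<lambda>v. S v + T v)"
proof -
  interpret W: seminormed_subspace W N' by fact
  obtain K where K: "0 \<le> K" "\<And>v. v \<in> V \<Longrightarrow> N' (S v) \<le> K * N v"
    using S unfolding bounded_linear_on_def by blast
  obtain L where L: "0 \<le> L" "\<And>v. v \<in> V \<Longrightarrow> N' (T v) \<le> L * N v"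
    using T unfolding bounded_linear_on_def by blast
  show ?thesis
  proof (rule bounded_linear_onI)
    show "linear_on V (\<lambda>v. S v + T v)"
      using S T unfolding bounded_linear_on_def linear_on_def by (auto simp: scaleR_add_right)
    show "S v + T v \<in> W" if "v \<in> V" for v
      using that S T by (simp add: bounded_linear_on_mem W.mem_add)
    show "N' (S v + T v) \<le> (K + L) * N v" if "v \<in> V" for v
    proof -
      have "N' (S v + T v) \<le> N' (S v) + N' (T v)"
        using that S T by (simp add: bounded_linear_on_mem W.triangle)
      with K(2)[OF that] L(2)[OF that] show ?thesis by (simp add: distrib_right)
    qed
  qed (use K L in simp)
qed

lemma bounded_linear_on_minus:
  assumes "seminormed_subspace W N'" and T: "bounded_linear_on V N W N' T"
  shows "bounded_linear_on V N W N' (\<lambda>v. - T v)"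
proof -
  interpret W: seminormed_subspace W N' by fact
  obtain K where K: "0 \<le> K" "\<And>v. v \<in> V \<Longrightarrow> N' (T v) \<le> K * N v"
    using T unfolding bounded_linear_on_def by blast
  show ?thesis
  proof (rule bounded_linear_onI)
    show "linear_on V (\<lambda>v. - T v)"
      using T unfolding bounded_linear_on_def linear_on_def by auto
  qed (use K T W.norm_minus in \<open>auto simp: bounded_linear_on_mem subspace_neg[OF W.subspace]\<close>)
qed

lemma bounded_linear_on_diff:
  assumes "seminormed_subspace W N'"
    and S: "bounded_linear_on V N W N' S" and T: "bounded_linear_on V N W N' T"
  shows "bounded_linear_on V N W N' (\<lambda>v. S v - T v)"
  using bounded_linear_on_add[OF assms(1) S bounded_linear_on_minus[OF assms(1) T]] by simp

lemma bounded_linear_on_id: "bounded_linear_on V N V N (\<lambda>v. v)"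
  by (rule bounded_linear_onI[of _ _ _ 1]) (auto simp: linear_on_def)

context seminormed_subspace
begin

lemma bounded_linear_on_l1_map:
  assumes T: "bounded_linear_on V N V N T"
  shows "bounded_linear_on (l1_sum V N) (l1_sum_norm N) (l1_sum V N) (l1_sum_norm N) (\<lambda>u n. T (u n))"
proof -
  obtain K where K: "0 \<le> K" "\<And>v. v \<in> V \<Longrightarrow> N (T v) \<le> K * N v"
    using T unfolding bounded_linear_on_def by blast
  have *: "(\<lambda>n. T (u n)) \<in> l1_sum V N" "l1_sum_norm N (\<lambda>n. T (u n)) \<le> K * l1_sum_norm N u"
    if "u \<in> l1_sum V N" for u
    using l1_sum_norm_bound[of "\<lambda>n. T (u n)" "\<lambda>n. K * N (u n)"] that K(2) T
    by (auto simp: l1_sum_iff l1_sum_norm_def bounded_linear_on_mem suminf_mult summable_mult)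
  show ?thesis
  proof (rule bounded_linear_onI)
    show "linear_on (l1_sum V N) (\<lambda>u n. T (u n))"
      using bounded_linear_on_linear[OF T] by (auto simp: linear_on_def l1_sum_iff fun_eq_iff)
  qed (use * K in auto)
qed

lemma bounded_linear_on_l1_hd: "bounded_linear_on (l1_sum V N) (l1_sum_norm N) V N (\<lambda>u. u 0)"
proof (rule bounded_linear_onI[where K = 1])
  show "N (u 0) \<le> 1 * l1_sum_norm N u" if "u \<in> l1_sum V N" for u
    using that sum_le_suminf[of "\<lambda>n. N (u n)" "{0}"] nonneg by (auto simp: l1_sum_iff l1_sum_norm_def)
qed (auto simp: l1_sum_iff linear_on_def)

lemma bounded_linear_on_l1_tl:
  "bounded_linear_on (l1_sum V N) (l1_sum_norm N) (l1_sum V N) (l1_sum_norm N) (\<lambda>u n. u (Suc n))"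
proof (rule bounded_linear_onI[where K = 1])
  show "l1_sum_norm N (\<lambda>n. u (Suc n)) \<le> 1 * l1_sum_norm N u" if "u \<in> l1_sum V N" for u
    using that suminf_split_head[of "\<lambda>n. N (u n)"] nonneg[of "u 0"] by (auto simp: l1_sum_iff l1_sum_norm_def)
qed (auto simp: l1_sum_iff linear_on_def summable_Suc_iff[where f = "\<lambda>n. N (_ n)"] fun_eq_iff)

lemma bounded_linear_on_l1_cons:
  assumes S: "bounded_linear_on U M V N S"
    and T: "bounded_linear_on U M (l1_sum V N) (l1_sum_norm N) T"
  shows "bounded_linear_on U M (l1_sum V N) (l1_sum_norm N) (\<lambda>u. case_nat (S u) (T u))"
proof -
  obtain K where K: "0 \<le> K" "\<And>u. u \<in> U \<Longrightarrow> N (S u) \<le> K * M u"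
    using S unfolding bounded_linear_on_def by blast
  obtain L where L: "0 \<le> L" "\<And>u. u \<in> U \<Longrightarrow> l1_sum_norm N (T u) \<le> L * M u"
    using T unfolding bounded_linear_on_def by blast
  have cons: "case_nat v w \<in> l1_sum V N" "l1_sum_norm N (case_nat v w) = N v + l1_sum_norm N w"
    if "v \<in> V" "w \<in> l1_sum V N" for v w
  proof -
    have s: "summable (\<lambda>n. N (case n of 0 \<Rightarrow> v | Suc x \<Rightarrow> w x))"
      using that summable_Suc_iff[of "\<lambda>n. N (case n of 0 \<Rightarrow> v | Suc x \<Rightarrow> w x)"] by (simp add: l1_sum_iff)
    then show "case_nat v w \<in> l1_sum V N"
      using that by (auto simp: l1_sum_iff split: nat.split)
    show "l1_sum_norm N (case_nat v w) = N v + l1_sum_norm N w"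
      unfolding l1_sum_norm_def using suminf_split_head[OF s] by simp
  qed
  show ?thesis
  proof (rule bounded_linear_onI)
    show "linear_on U (\<lambda>u. case_nat (S u) (T u))"
      using bounded_linear_on_linear[OF S] bounded_linear_on_linear[OF T]
      by (auto simp: linear_on_def fun_eq_iff split: nat.split)
    show "case_nat (S u) (T u) \<in> l1_sum V N" if "u \<in> U" for u
      by (rule cons[OF bounded_linear_on_mem[OF S that] bounded_linear_on_mem[OF T that]])
    show "l1_sum_norm N (case_nat (S u) (T u)) \<le> (K + L) * M u" if "u \<in> U" for u
      using that S T K(2)[of u] L(2)[of u] by (simp add: cons bounded_linear_on_mem distrib_right)
  qed (use K L in simp)
qed

text \<open>
  With \<open>Q = id - J P\<close>, the swindle moves the \<open>Q\<close>-part of each coordinate of \<open>P x\<close> one place to the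
  right and puts the \<open>Q\<close>-part of \<open>x\<close> itself into the vacated place.
\<close>

lemma linearly_isomorphic_l1_sum_if_complemented:
  assumes J: "bounded_linear_on (l1_sum V N) (l1_sum_norm N) V N J"
    and P: "bounded_linear_on V N (l1_sum V N) (l1_sum_norm N) P"
    and PJ: "\<And>u. u \<in> l1_sum V N \<Longrightarrow> P (J u) = u"
  shows "linearly_isomorphic V N (l1_sum V N) (l1_sum_norm N)"
proof -
  let ?Z = "l1_sum V N" and ?NZ = "l1_sum_norm N"
  interpret Z: seminormed_subspace ?Z ?NZ by (rule seminormed_l1_sum)
  have sn: "seminormed_subspace V N" by unfold_locales
  define R where "R = (\<lambda>v. J (P v))"
  define Q where "Q = (\<lambda>v. v - R v)"
  have bR: "bounded_linear_on V N V N R"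
    unfolding R_def by (rule bounded_linear_on_compose[OF P J])
  have bQ: "bounded_linear_on V N V N Q"
    unfolding Q_def by (rule bounded_linear_on_diff[OF sn bounded_linear_on_id bR])
  \<comment> \<open>\<open>(Q, P)\<close> identifies \<open>V\<close> with \<open>Q V\<close> plus
    the l1-sum, and the l1-sum splits coordinatewise into \<open>R\<close>- and
    \<open>Q\<close>-parts. The additional copy of \<open>Q V\<close> is absorbed by shifting the
    sequence of \<open>Q\<close>-parts.\<close>
  define F where "F = (\<lambda>v. (\<lambda>n. R (P v n)) + case_nat (Q v) (\<lambda>n. Q (P v n)))"
  \<comment> \<open>The inverse shift: the \<open>Q\<close>-part of slot 0 is returned to
    \<open>V\<close> directly, the other \<open>Q\<close>-parts move one place left, rejoin their
    \<open>R\<close>-parts and are reassembled by \<open>J\<close>.\<close>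
  define G where "G = (\<lambda>u. Q (u 0) + J ((\<lambda>n. R (u n)) + (\<lambda>n. Q (u (Suc n)))))"
  have bF: "bounded_linear_on V N ?Z ?NZ F"
    unfolding F_def
    by (intro bounded_linear_on_add[OF Z.seminormed_subspace_axioms] bounded_linear_on_l1_cons bQ
        bounded_linear_on_compose[OF P bounded_linear_on_l1_map] bR)
  have bG: "bounded_linear_on ?Z ?NZ V N G"
    unfolding G_def
    by (intro bounded_linear_on_add[OF sn] bounded_linear_on_compose[OF _ J]
        bounded_linear_on_add[OF Z.seminormed_subspace_axioms]
        bounded_linear_on_compose[OF bounded_linear_on_l1_hd bQ]
        bounded_linear_on_compose[OF bounded_linear_on_l1_tl bounded_linear_on_l1_map[OF bQ]]
        bounded_linear_on_l1_map bR)
  have mem: "R v \<in> V" "Q v \<in> V" "P v \<in> ?Z" "P v n \<in> V" if "v \<in> V" for v n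
    using bounded_linear_on_mem[OF bR that] bounded_linear_on_mem[OF bQ that]
      bounded_linear_on_mem[OF P that] by (simp_all add: l1_sum_iff)
  have memZ: "J u \<in> V" "u n \<in> V" if "u \<in> ?Z" for u n
    using that J by (auto simp: bounded_linear_on_mem l1_sum_iff)
  have add: "R (v + w) = R v + R w" "Q (v + w) = Q v + Q w" "P (v + w) = P v + P w"
    if "v \<in> V" "w \<in> V" for v w
    using that bounded_linear_on_linear[OF bR] bounded_linear_on_linear[OF bQ]
      bounded_linear_on_linear[OF P] by (auto simp: linear_on_def)
  \<comment> \<open>\<open>R\<close> and \<open>Q\<close> are complementary projections, with the
    range of \<open>J\<close> fixed by \<open>R\<close> and \<open>P\<close> vanishing on the range
    of \<open>Q\<close>; the cancellations in \<open>GF\<close> and \<open>FG\<close> use only these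
    rules.\<close>
  have RJ: "R (J u) = J u" and QJ: "Q (J u) = 0" if "u \<in> ?Z" for u
    using that by (simp_all add: R_def Q_def PJ)
  have PQ: "P (Q v) = 0" if "v \<in> V" for v
    using that linear_on_diff[OF bounded_linear_on_linear[OF P] subspace, of v "R v"] mem
    by (simp add: Q_def) (simp add: R_def PJ)
  have RR: "R (R v) = R v" "Q (R v) = 0" if "v \<in> V" for v
    using RJ[OF mem(3)[OF that]] QJ[OF mem(3)[OF that]] unfolding R_def by blast+
  have RQ: "R (Q v) = 0" "Q (Q v) = Q v" if "v \<in> V" for v
    using linear_on_0[OF bounded_linear_on_linear[OF J] Z.subspace] PQ[OF that]
    by (simp_all add: R_def Q_def)
  have RQsum: "R v + Q v = v" for v by (simp add: Q_def)
  have GF: "G (F v) = v" if v: "v \<in> V" for v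
  proof -
    have "(\<lambda>n. R (F v n)) + (\<lambda>n. Q (F v (Suc n))) = P v"
    proof
      fix n
      show "((\<lambda>n. R (F v n)) + (\<lambda>n. Q (F v (Suc n)))) n = P v n"
        using v mem by (cases n) (auto simp: F_def add RR RQ RQsum)
    qed
    moreover have "Q (F v 0) = Q v"
      using v mem by (simp add: F_def add RR RQ)
    ultimately show ?thesis
      using RQsum[of v] unfolding G_def by (simp add: R_def add.commute)
  qed
  have FG: "F (G u) = u" if u: "u \<in> ?Z" for u
  proof -
    let ?w = "(\<lambda>n. R (u n)) + (\<lambda>n. Q (u (Suc n)))"
    have w: "?w \<in> ?Z"
      using u bounded_linear_on_mem[OF bounded_linear_on_l1_map[OF bR]]
        bounded_linear_on_mem[OF bounded_linear_on_compose[OF bounded_linear_on_l1_tl bounded_linear_on_l1_map[OF bQ]]]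
      by (intro Z.mem_add) auto
    have PG: "P (G u) = ?w"
      unfolding G_def using memZ[OF w] memZ[OF u] mem by (simp add: add PQ PJ w)
    have QG: "Q (G u) = Q (u 0)"
      unfolding G_def using memZ[OF w] memZ[OF u] mem by (simp add: add QJ RQ w)
    show ?thesis
    proof
      fix n
      show "F (G u) n = u n"
        unfolding F_def PG QG using memZ[OF u] mem by (cases n) (auto simp: add RR RQ RQsum)
    qed
  qed
  have bij: "bij_betw F V ?Z"
    using GF FG bF bG by (intro bij_betw_byWitness[of _ G]) (auto simp: bounded_linear_on_mem)
  obtain K where K: "\<And>v. v \<in> V \<Longrightarrow> ?NZ (F v) \<le> K * N v"
    using bF unfolding bounded_linear_on_def by blast
  obtain L where L: "\<And>u. u \<in> ?Z \<Longrightarrow> N (G u) \<le> L * ?NZ u"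
    using bG unfolding bounded_linear_on_def by blast
  have "N v \<le> L * ?NZ (F v)" if "v \<in> V" for v
    using L[of "F v"] GF[OF that] bounded_linear_on_mem[OF bF that] by simp
  with K bij bounded_linear_on_linear[OF bF] show ?thesis
    unfolding linearly_isomorphic_def by blast
qed

end


section \<open>Duals and adjoints\<close>

context seminormed_subspace
begin

lemma dual_spaceI:
  assumes "linear_on V m" "\<And>v. v \<in> V \<Longrightarrow> \<bar>m v\<bar> \<le> K * N v" "\<And>v. v \<notin> V \<Longrightarrow> m v = 0"
  shows "m \<in> dual_space V N"
  using assms by (auto simp: dual_space_def)

lemma dual_space_linear: "m \<in> dual_space V N \<Longrightarrow> linear_on V m"
  and dual_space_outside: "m \<in> dual_space V N \<Longrightarrow> v \<notin> V \<Longrightarrow> m v = 0"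
  by (auto simp: dual_space_def)

lemma dual_set_bdd:
  assumes "m \<in> dual_space V N"
  shows "bdd_above {\<bar>m v\<bar> |v. v \<in> V \<and> N v \<le> 1}"
proof -
  obtain K where K: "\<And>v. v \<in> V \<Longrightarrow> \<bar>m v\<bar> \<le> K * N v"
    using assms by (auto simp: dual_space_def)
  have "\<bar>m v\<bar> \<le> \<bar>K\<bar>" if "v \<in> V" "N v \<le> 1" for v
  proof -
    have "K * N v \<le> \<bar>K\<bar> * 1"
      using nonneg that by (intro mult_mono) auto
    with K[OF that(1)] show ?thesis by simp
  qed
  then show ?thesis by (auto intro!: bdd_aboveI[of _ "\<bar>K\<bar>"])
qed

lemma dual_ineq:
  assumes m: "m \<in> dual_space V N" and v: "v \<in> V"
  shows "\<bar>m v\<bar> \<le> dual_norm V N m * N v"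
\<comment> \<open>A seminorm may vanish at a nonzero \<open>v\<close>; the bound in
  \<open>dual_space\<close> then forces \<open>m v = 0\<close>.\<close>
proof (cases "N v = 0")
  case True
  then show ?thesis using assms by (fastforce simp: dual_space_def)
next
  case False
  then have pos: "N v > 0" using nonneg[OF v] by simp
  let ?w = "inverse (N v) *\<^sub>R v"
  have "N ?w \<le> 1" using scale_le[OF v, of "inverse (N v)"] pos by simp
  then have "\<bar>m ?w\<bar> \<le> dual_norm V N m"
    unfolding dual_norm_def using mem_scale[OF v] by (intro cSup_upper dual_set_bdd[OF m]) blast
  moreover have "m ?w = inverse (N v) * m v"
    using linear_onD(2)[OF dual_space_linear[OF m] v] by simp
  ultimately have "inverse (N v) * \<bar>m v\<bar> \<le> dual_norm V N m" using pos by (simp add: abs_mult)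
  with pos show ?thesis by (simp add: field_simps)
qed

lemma dual_norm_le:
  assumes "0 \<le> K" "\<And>v. v \<in> V \<Longrightarrow> \<bar>m v\<bar> \<le> K * N v"
  shows "dual_norm V N m \<le> K"
  unfolding dual_norm_def
proof (rule cSup_least)
  show "{\<bar>m v\<bar> |v. v \<in> V \<and> N v \<le> 1} \<noteq> {}" using mem_0 norm_0 by force
  show "x \<le> K" if "x \<in> {\<bar>m v\<bar> |v. v \<in> V \<and> N v \<le> 1}" for x
    using that assms mult_left_le[of _ K] by fastforce
qed

text \<open>Replacing \<open>v\<close> by \<open>- v\<close> removes the absolute value, so that
  near-norming vectors of several functionals can later be added without cancellation.\<close>

lemma dual_norm_approx:
  assumes m: "m \<in> dual_space V N" and "0 < e"
  obtains v where "v \<in> V" "N v \<le> 1" "dual_norm V N m - e < m v"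
proof -
  have "{\<bar>m v\<bar> |v. v \<in> V \<and> N v \<le> 1} \<noteq> {}" using mem_0 norm_0 by force
  then obtain v where v: "v \<in> V" "N v \<le> 1" "dual_norm V N m - e < \<bar>m v\<bar>"
    using less_cSup_iff[OF _ dual_set_bdd[OF m], of "dual_norm V N m - e"] \<open>0 < e\<close>
    by (auto simp: dual_norm_def)
  have "m (- v) = - m v"
    using linear_on_diff[OF dual_space_linear[OF m] subspace mem_0 v(1)]
      linear_on_0[OF dual_space_linear[OF m] subspace] by simp
  moreover have "- v \<in> V" using v subspace subspace_neg by blast
  ultimately show ?thesis
    using that[of v] that[of "- v"] v norm_minus by (cases "m v \<ge> 0") auto
qed

lemma seminormed_dual_space: "seminormed_subspace (dual_space V N) (dual_norm V N)"
proof
  have nn: "0 \<le> dual_norm V N m" if "m \<in> dual_space V N" for m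
    unfolding dual_norm_def using mem_0 norm_0 by (intro cSup_upper2[OF _ _ dual_set_bdd[OF that]]) auto
  have add: "u + v \<in> dual_space V N \<and> dual_norm V N (u + v) \<le> dual_norm V N u + dual_norm V N v"
    if "u \<in> dual_space V N" "v \<in> dual_space V N" for u v
  proof -
    have *: "\<bar>(u + v) f\<bar> \<le> (dual_norm V N u + dual_norm V N v) * N f" if "f \<in> V" for f
      using dual_ineq[of u f] dual_ineq[of v f] \<open>u \<in> _\<close> \<open>v \<in> _\<close> that
      by (simp add: distrib_right)
    have "linear_on V (u + v)"
      using linear_onD[OF dual_space_linear[OF that(1)]] linear_onD[OF dual_space_linear[OF that(2)]]
      by (simp add: linear_on_def algebra_simps)
    then have "u + v \<in> dual_space V N"
      by (rule dual_spaceI[OF _ *]) (simp_all add: that dual_space_outside)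
    with * nn that show ?thesis by (auto intro!: dual_norm_le)
  qed
  have scale: "c *\<^sub>R u \<in> dual_space V N \<and> dual_norm V N (c *\<^sub>R u) \<le> \<bar>c\<bar> * dual_norm V N u"
    if "u \<in> dual_space V N" for u c
  proof -
    have *: "\<bar>(c *\<^sub>R u) f\<bar> \<le> (\<bar>c\<bar> * dual_norm V N u) * N f" if "f \<in> V" for f
      using mult_left_mono[OF dual_ineq[of u f], of "\<bar>c\<bar>"] \<open>u \<in> _\<close> that by (simp add: abs_mult mult.assoc)
    have "linear_on V (c *\<^sub>R u)"
      using linear_onD[OF dual_space_linear[OF that]] by (simp add: linear_on_def algebra_simps)
    then have "c *\<^sub>R u \<in> dual_space V N"
      by (rule dual_spaceI[OF _ *]) (simp_all add: that dual_space_outside)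
    with * nn that show ?thesis by (auto intro!: dual_norm_le)
  qed
  have "0 \<in> dual_space V N"
    by (rule dual_spaceI[where K = 0]) (auto simp: linear_on_def)
  with add scale show "subspace (dual_space V N)" by (auto simp: subspace_def)
  show "dual_norm V N (u + v) \<le> dual_norm V N u + dual_norm V N v"
    if "u \<in> dual_space V N" "v \<in> dual_space V N" for u v using add that by blast
  show "dual_norm V N (c *\<^sub>R u) \<le> \<bar>c\<bar> * dual_norm V N u" if "u \<in> dual_space V N" for u c
    using scale that by blast
qed

lemma subset_norm_closure: "A \<subseteq> V \<Longrightarrow> A \<subseteq> norm_closure V N A"
  using norm_0 by (force simp: norm_closure_def)

text \<open>Idempotence of the closure, used to place explicitly constructed limits in the free
  space.\<close>

lemma norm_closure_closed:
  assumes "A \<subseteq> V" "v \<in> V" "\<And>e. 0 < e \<Longrightarrow> \<exists>w \<in> norm_closure V N A. N (v - w) < e"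
  shows "v \<in> norm_closure V N A"
  unfolding norm_closure_def
proof (intro CollectI conjI allI impI \<open>v \<in> V\<close>)
  fix e :: real assume "0 < e"
  then obtain w where w: "w \<in> norm_closure V N A" "N (v - w) < e / 2"
    using assms(3)[of "e/2"] by auto
  then obtain a where a: "a \<in> A" "N (w - a) < e / 2"
    unfolding norm_closure_def using \<open>0 < e\<close> half_gt_zero by blast
  have "w \<in> V" using w by (simp add: norm_closure_def)
  then have "N (v - a) \<le> N (v - w) + N (w - a)"
    using triangle[of "v - w" "w - a"] assms a by (auto simp: mem_diff)
  then show "\<exists>a\<in>A. N (v - a) < e" using a w by (intro bexI[of _ a]) auto
qed

lemma seminormed_norm_closure:
  assumes A: "subspace A" "A \<subseteq> V"
  shows "seminormed_subspace (norm_closure V N A) N"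
proof
  have cl: "norm_closure V N A \<subseteq> V" by (auto simp: norm_closure_def)
  show "subspace (norm_closure V N A)"
  proof (rule subspaceI)
    show "0 \<in> norm_closure V N A" using subset_norm_closure[OF A(2)] subspace_0[OF A(1)] by blast
    show "u + v \<in> norm_closure V N A"
      if "u \<in> norm_closure V N A" "v \<in> norm_closure V N A" for u v
      unfolding norm_closure_def
    proof (intro CollectI conjI allI impI)
      fix e :: real assume "0 < e"
      with that obtain a b where ab: "a \<in> A" "N (u - a) < e / 2" "b \<in> A" "N (v - b) < e / 2"
        unfolding norm_closure_def using half_gt_zero by blast
      have "(u + v) - (a + b) = (u - a) + (v - b)" by simp
      then have "N ((u + v) - (a + b)) = N ((u - a) + (v - b))" by (rule arg_cong)
      moreover have "u - a \<in> V" "v - b \<in> V"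
        using that ab cl A(2) by (auto intro!: mem_diff)
      ultimately have "N ((u + v) - (a + b)) < e"
        using triangle[of "u - a" "v - b"] ab by linarith
      then show "\<exists>a\<in>A. N (u + v - a) < e" using subspace_add[OF A(1)] ab by blast
    qed (use that cl mem_add in blast)
    show "c *\<^sub>R u \<in> norm_closure V N A" if u: "u \<in> norm_closure V N A" for u c
      unfolding norm_closure_def
    proof (intro CollectI conjI allI impI)
      fix e :: real assume "0 < e"
      then have "0 < e / (\<bar>c\<bar> + 1)" by simp
      with u obtain a where a: "a \<in> A" "N (u - a) < e / (\<bar>c\<bar> + 1)"
        unfolding norm_closure_def by blast
      have ua: "u - a \<in> V" using u cl a A(2) mem_diff by blast
      have "N (c *\<^sub>R u - c *\<^sub>R a) \<le> \<bar>c\<bar> * N (u - a)"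
        using scale_le[OF ua, of c] by (simp add: scaleR_diff_right)
      also have "\<dots> \<le> (\<bar>c\<bar> + 1) * N (u - a)"
        using nonneg[OF ua] by (simp add: distrib_right)
      also have "\<dots> < e" using a(2) by (simp add: field_simps)
      finally show "\<exists>a\<in>A. N (c *\<^sub>R u - a) < e" using subspace_scale[OF A(1) a(1)] by blast
    qed (use u cl mem_scale in blast)
  qed
  show "N (u + v) \<le> N u + N v" if "u \<in> norm_closure V N A" "v \<in> norm_closure V N A" for u v
    using triangle that cl by blast
  show "N (c *\<^sub>R u) \<le> \<bar>c\<bar> * N u" if "u \<in> norm_closure V N A" for u c
    using scale_le that cl by blast
qed

end

text \<open>Cut off to \<open>0\<close> outside \<open>V\<close>, in accordance with the
  representation of functionals in \<open>dual_space\<close>.\<close>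

definition adjoint_on :: "'v set \<Rightarrow> ('v \<Rightarrow> 'w) \<Rightarrow> ('w \<Rightarrow> real) \<Rightarrow> 'v \<Rightarrow> real"
  where "adjoint_on V T m = (\<lambda>v. if v \<in> V then m (T v) else 0)"

lemma adjoint_on_linear: "linear_on D (adjoint_on V T)"
  by (auto simp: linear_on_def adjoint_on_def fun_eq_iff)

lemma adjoint_on_dual:
  assumes "seminormed_subspace V N" "seminormed_subspace W N'"
    and T: "linear_on V T" "T ` V \<subseteq> W" and K: "0 \<le> K" "\<And>v. v \<in> V \<Longrightarrow> N' (T v) \<le> K * N v"
    and m: "m \<in> dual_space W N'"
  shows "adjoint_on V T m \<in> dual_space V N"
    and "dual_norm V N (adjoint_on V T m) \<le> K * dual_norm W N' m"
proof -
  interpret V: seminormed_subspace V N by fact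
  interpret W: seminormed_subspace W N' by fact
  interpret D: seminormed_subspace "dual_space W N'" "dual_norm W N'" by (rule W.seminormed_dual_space)
  have *: "\<bar>adjoint_on V T m v\<bar> \<le> (K * dual_norm W N' m) * N v" if v: "v \<in> V" for v
  proof -
    have "\<bar>m (T v)\<bar> \<le> dual_norm W N' m * N' (T v)"
      using W.dual_ineq[OF m] T v by blast
    also have "\<dots> \<le> dual_norm W N' m * (K * N v)"
      by (intro mult_left_mono K v D.nonneg m)
    finally show ?thesis using v by (simp add: adjoint_on_def mult_ac)
  qed
  show "adjoint_on V T m \<in> dual_space V N"
    using W.dual_space_linear[OF m] T V.subspace
    by (intro V.dual_spaceI[OF _ *])
      (auto simp: linear_on_def adjoint_on_def image_subset_iff V.mem_add V.mem_scale)
  show "dual_norm V N (adjoint_on V T m) \<le> K * dual_norm W N' m"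
    by (intro V.dual_norm_le * mult_nonneg_nonneg K D.nonneg m)
qed

text \<open>The adjoint is linear and norm continuous and the closure of \<open>B\<close> is a
  closed subspace, so the generators in \<open>A\<close> decide.\<close>

lemma adjoint_on_norm_closure:
  assumes V: "seminormed_subspace V N" and W: "seminormed_subspace W N'"
    and T: "bounded_linear_on V N W N' T"
    and B: "subspace B" "B \<subseteq> dual_space V N" and A: "A \<subseteq> dual_space W N'"
    and AB: "\<And>a. a \<in> A \<Longrightarrow> adjoint_on V T a \<in> norm_closure (dual_space V N) (dual_norm V N) B"
    and m: "m \<in> norm_closure (dual_space W N') (dual_norm W N') (span A)"
  shows "adjoint_on V T m \<in> norm_closure (dual_space V N) (dual_norm V N) B"
proof -
  interpret V: seminormed_subspace V N by fact
  interpret W: seminormed_subspace W N' by fact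
  interpret D: seminormed_subspace "dual_space V N" "dual_norm V N" by (rule V.seminormed_dual_space)
  interpret E: seminormed_subspace "dual_space W N'" "dual_norm W N'" by (rule W.seminormed_dual_space)
  let ?B = "norm_closure (dual_space V N) (dual_norm V N) B"
  interpret B: seminormed_subspace ?B "dual_norm V N"
    by (rule D.seminormed_norm_closure[OF B])
  obtain K where K: "0 \<le> K" "\<And>v. v \<in> V \<Longrightarrow> N' (T v) \<le> K * N v"
    using T unfolding bounded_linear_on_def by blast
  have TVW: "T ` V \<subseteq> W" using T by (auto simp: bounded_linear_on_mem)
  have adj: "adjoint_on V T m \<in> dual_space V N"
      "dual_norm V N (adjoint_on V T m) \<le> K * dual_norm W N' m" if "m \<in> dual_space W N'" for m
    using adjoint_on_dual[OF V W bounded_linear_on_linear[OF T] TVW K that] by blast+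
  have span: "adjoint_on V T a \<in> ?B" if "a \<in> span A" for a
    using that
  proof (induction rule: span_induct)
    case base
    show "subspace {x. adjoint_on V T x \<in> ?B}"
      using B.mem_0 B.mem_add B.mem_scale linear_onD[OF adjoint_on_linear[of UNIV V T]]
        linear_on_0[OF adjoint_on_linear[of UNIV V T]]
      by (auto simp: subspace_def)
  qed (use AB in auto)
  have spanA: "span A \<subseteq> dual_space W N'" using span_minimal[OF A E.subspace] .
  have mD: "m \<in> dual_space W N'" using m by (simp add: norm_closure_def)
  show ?thesis
  proof (rule D.norm_closure_closed[OF B(2) adj(1)[OF mD]])
    fix e :: real assume "0 < e"
    then have "0 < e / (K + 1)" using K(1) by simp
    then obtain a where a: "a \<in> span A" "dual_norm W N' (m - a) < e / (K + 1)"
      using m unfolding norm_closure_def by blast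
    have ma: "m - a \<in> dual_space W N'" using mD a(1) spanA E.mem_diff by blast
    have "adjoint_on V T m - adjoint_on V T a = adjoint_on V T (m - a)"
      by (auto simp: adjoint_on_def)
    then have "dual_norm V N (adjoint_on V T m - adjoint_on V T a) \<le> K * dual_norm W N' (m - a)"
      using adj(2)[OF ma] by simp
    also have "\<dots> \<le> (K + 1) * dual_norm W N' (m - a)"
      using E.nonneg[OF ma] by (simp add: distrib_right)
    also have "\<dots> < e" using a(2) K(1) by (simp add: field_simps)
    finally show "\<exists>w\<in>?B. dual_norm V N (adjoint_on V T m - w) < e" using span[OF a(1)] by blast
  qed
qed

context seminormed_subspace
begin

text \<open>The limit is written down as the pointwise sum, which converges absolutely by
  \<open>dual_ineq\<close>. It lies in \<open>X\<close> because the partial sums do and the tails of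
  the norm series bound the error.\<close>

lemma bounded_linear_on_l1_suminf:
  assumes A: "subspace A" "A \<subseteq> dual_space V N"
  defines "X \<equiv> norm_closure (dual_space V N) (dual_norm V N) A"
  shows "bounded_linear_on (l1_sum X (dual_norm V N)) (l1_sum_norm (dual_norm V N)) X (dual_norm V N)
    (\<lambda>u v. \<Sum>n. u n v)"
proof -
  interpret D: seminormed_subspace "dual_space V N" "dual_norm V N" by (rule seminormed_dual_space)
  interpret X: seminormed_subspace X "dual_norm V N"
    unfolding X_def by (rule D.seminormed_norm_closure[OF A])
  let ?Y = "l1_sum X (dual_norm V N)" and ?NY = "l1_sum_norm (dual_norm V N)"
  have XD: "X \<subseteq> dual_space V N" by (auto simp: X_def norm_closure_def)
  have summ: "summable (\<lambda>n. \<bar>u n v\<bar>) \<and> (\<Sum>n. \<bar>u n v\<bar>) \<le> ?NY u * N v"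
    if u: "u \<in> ?Y" and v: "v \<in> V" for u v
  proof -
    have le: "\<bar>u n v\<bar> \<le> dual_norm V N (u n) * N v" for n
      using u v XD by (intro dual_ineq) (auto simp: X.l1_sum_iff)
    have s: "summable (\<lambda>n. dual_norm V N (u n) * N v)"
      using u by (auto simp: X.l1_sum_iff intro: summable_mult2)
    have s': "summable (\<lambda>n. \<bar>u n v\<bar>)"
      by (rule summable_comparison_test'[OF s, of 0]) (use le in auto)
    moreover have "(\<Sum>n. \<bar>u n v\<bar>) \<le> (\<Sum>n. dual_norm V N (u n) * N v)"
      by (rule suminf_le[OF le s' s])
    moreover have "\<dots> = ?NY u * N v"
      using u by (subst suminf_mult2[symmetric]) (auto simp: X.l1_sum_iff l1_sum_norm_def)
    ultimately show ?thesis by simp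
  qed
  have outside: "u n v = 0" if "u \<in> ?Y" "v \<notin> V" for u n v
    using that XD dual_space_outside[of "u n" v] by (auto simp: X.l1_sum_iff)
  have summable: "summable (\<lambda>n. u n v)" if "u \<in> ?Y" for u v
  proof (cases "v \<in> V")
    case True
    with summ[OF that True] show ?thesis by (auto intro: summable_rabs_cancel)
  qed (use outside[OF that] in simp)
  have bound: "\<bar>\<Sum>n. u n v\<bar> \<le> ?NY u * N v" if "u \<in> ?Y" "v \<in> V" for u v
    using summ[OF that] summable_rabs[of "\<lambda>n. u n v"] by linarith
  have lin: "linear_on V (u n)" if "u \<in> ?Y" for u n
    using that XD by (auto simp: X.l1_sum_iff intro: dual_space_linear)
  have NY0: "0 \<le> ?NY u" if "u \<in> ?Y" for u
    using that X.nonneg by (auto simp: l1_sum_norm_def X.l1_sum_iff intro!: suminf_nonneg)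
  have dual: "(\<lambda>v. \<Sum>n. u n v) \<in> dual_space V N" if u: "u \<in> ?Y" for u
  proof (rule dual_spaceI[OF _ bound[OF u]])
    show "linear_on V (\<lambda>v. \<Sum>n. u n v)"
      using linear_onD[OF lin[OF u]] summable[OF u]
      by (auto simp: linear_on_def suminf_add suminf_mult)
  qed (use outside[OF u] in auto)
  have norm: "dual_norm V N (\<lambda>v. \<Sum>n. u n v) \<le> ?NY u" if u: "u \<in> ?Y" for u
    by (rule dual_norm_le[OF NY0[OF u] bound[OF u]])
  show ?thesis
  proof (rule bounded_linear_onI[where K = 1])
    show "linear_on ?Y (\<lambda>u v. \<Sum>n. u n v)"
      using summable by (auto simp: linear_on_def fun_eq_iff suminf_add suminf_mult)
    show "(\<lambda>v. \<Sum>n. u n v) \<in> X" if u: "u \<in> ?Y" for u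
      unfolding X_def
    proof (rule D.norm_closure_closed[OF A(2) dual[OF u]])
      fix e :: real assume "0 < e"
      have sN: "summable (\<lambda>n. dual_norm V N (u n))" using u by (simp add: X.l1_sum_iff)
      obtain k where k: "\<bar>\<Sum>n. dual_norm V N (u (n + k))\<bar> < e"
        using suminf_exist_split[OF \<open>0 < e\<close> sN] by auto
      have uk: "(\<lambda>n. u (n + k)) \<in> ?Y"
        using u sN by (simp add: X.l1_sum_iff summable_iff_shift[of "\<lambda>n. dual_norm V N (u n)"])
      have "(\<lambda>v. \<Sum>n. u n v) - (\<Sum>n<k. u n) = (\<lambda>v. \<Sum>n. u (n + k) v)"
        using suminf_split_initial_segment[OF summable[OF u], of _ k]
        by (auto simp: fun_eq_iff sum_fun_apply)
      then have "dual_norm V N ((\<lambda>v. \<Sum>n. u n v) - (\<Sum>n<k. u n)) < e"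
        using norm[OF uk] k by (simp add: l1_sum_norm_def)
      moreover have "(\<Sum>n<k. u n) \<in> X" using u by (auto simp: X.l1_sum_iff intro: X.mem_sum)
      ultimately show "\<exists>w\<in>norm_closure (dual_space V N) (dual_norm V N) A.
          dual_norm V N ((\<lambda>v. \<Sum>n. u n v) - w) < e"
        unfolding X_def by blast
    qed
  qed (use norm in auto)
qed

text \<open>Duality of l1 and l-infinity: with \<open>f k\<close> almost norming for the
  \<open>k\<close>-th adjoint, the sum of norms is nearly \<open>m\<close> applied to the single
  vector \<open>\<Sum>k<n. T k (f k)\<close>, whose norm is at most \<open>K\<close>.\<close>

lemma sum_dual_norm_adjoint_le:
  fixes n :: nat
  assumes T: "\<And>k. linear_on V (T k)" "\<And>k v. v \<in> V \<Longrightarrow> T k v \<in> V"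
    and adj: "\<And>k. adjoint_on V (T k) m \<in> dual_space V N"
    and K: "\<And>f. (\<And>k. f k \<in> V \<and> N (f k) \<le> 1) \<Longrightarrow> N (\<Sum>k<n. T k (f k)) \<le> K"
    and m: "m \<in> dual_space V N"
  shows "(\<Sum>k<n. dual_norm V N (adjoint_on V (T k) m)) \<le> K * dual_norm V N m"
proof (rule field_le_epsilon)
  interpret D: seminormed_subspace "dual_space V N" "dual_norm V N" by (rule seminormed_dual_space)
  fix e :: real assume "0 < e"
  \<comment> \<open>The \<open>n\<close> errors together stay below \<open>e\<close>; the
    \<open>+ 1\<close> covers \<open>n = 0\<close>.\<close>
  then have e: "0 < e / (real n + 1)" by simp
  have "\<exists>v. v \<in> V \<and> N v \<le> 1
      \<and> dual_norm V N (adjoint_on V (T k) m) - e / (real n + 1) < adjoint_on V (T k) m v" for k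
    using dual_norm_approx[OF adj e] by metis
  then obtain f where f: "\<And>k. f k \<in> V" "\<And>k. N (f k) \<le> 1"
    "\<And>k. dual_norm V N (adjoint_on V (T k) m) - e / (real n + 1) < adjoint_on V (T k) m (f k)"
    by metis
  have "(\<Sum>k<n. dual_norm V N (adjoint_on V (T k) m)) \<le> (\<Sum>k<n. m (T k (f k)) + e / (real n + 1))"
    using f by (intro sum_mono) (auto simp: adjoint_on_def less_eq_real_def algebra_simps)
  also have "\<dots> = m (\<Sum>k<n. T k (f k)) + real n * (e / (real n + 1))"
    using linear_on_sum[OF dual_space_linear[OF m] subspace, of "{..<n}" "\<lambda>k. T k (f k)"] T f
    by (simp add: sum.distrib)
  also have "m (\<Sum>k<n. T k (f k)) \<le> dual_norm V N m * N (\<Sum>k<n. T k (f k))"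
    using dual_ineq[OF m mem_sum, of "{..<n}" "\<lambda>k. T k (f k)"] T f by auto
  also have "\<dots> \<le> dual_norm V N m * K"
    using f by (intro mult_left_mono K D.nonneg m) auto
  also have "real n * (e / (real n + 1)) \<le> e"
    using \<open>0 < e\<close> by (simp add: field_simps)
  finally show "(\<Sum>k<n. dual_norm V N (adjoint_on V (T k) m)) \<le> K * dual_norm V N m + e"
    by (simp add: mult.commute)
qed

text \<open>
  The maps \<open>S k\<close> and \<open>T k\<close> are pre-adjoint to a factorisation of the identity of the \<open>\<ell>\<^sub>1\<close>-sum
  through \<open>X\<close>; the bound on \<open>T\<close> says that \<open>(f k) \<mapsto> \<Sum>k. T k (f k)\<close> is bounded on the
  \<open>\<ell>\<^sub>\<infinity>\<close>-sum.
\<close>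

lemma linearly_isomorphic_l1_sum_if_factors:
  fixes S T :: "nat \<Rightarrow> 'v \<Rightarrow> 'v"
  assumes A: "subspace A" "A \<subseteq> dual_space V N"
  defines "X \<equiv> norm_closure (dual_space V N) (dual_norm V N) A"
  assumes T: "\<And>k. linear_on V (T k)" "\<And>k v. v \<in> V \<Longrightarrow> T k v \<in> V"
      "\<And>k m. m \<in> X \<Longrightarrow> adjoint_on V (T k) m \<in> X"
      "\<And>n f. (\<And>k. f k \<in> V \<and> N (f k) \<le> 1) \<Longrightarrow> N (\<Sum>k<n. T k (f k)) \<le> K"
    and S: "\<And>k. linear_on V (S k)" "\<And>k v. v \<in> V \<Longrightarrow> S k v \<in> V"
      "\<And>k m. m \<in> X \<Longrightarrow> adjoint_on V (S k) m \<in> X"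
      "\<And>k v. v \<in> V \<Longrightarrow> N (S k v) \<le> L * N v"
    and ST: "\<And>k l v. v \<in> V \<Longrightarrow> S l (T k v) = (if k = l then v else 0)"
  shows "linearly_isomorphic X (dual_norm V N) (l1_sum X (dual_norm V N)) (l1_sum_norm (dual_norm V N))"
proof -
  interpret D: seminormed_subspace "dual_space V N" "dual_norm V N" by (rule seminormed_dual_space)
  interpret X: seminormed_subspace X "dual_norm V N"
    unfolding X_def by (rule D.seminormed_norm_closure[OF A])
  let ?Y = "l1_sum X (dual_norm V N)" and ?NY = "l1_sum_norm (dual_norm V N)"
  have XD: "X \<subseteq> dual_space V N" by (auto simp: X_def norm_closure_def)
  have K0: "0 \<le> K" using T(4)[of "\<lambda>_. 0" 0] by (simp add: mem_0 norm_0)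
  \<comment> \<open>\<open>L\<close> may be negative if the seminorm is zero, whereas the adjoint
    bound needs a nonnegative constant.\<close>
  have S': "N (S k v) \<le> \<bar>L\<bar> * N v" if "v \<in> V" for k v
    using S(4)[OF that, of k] mult_right_mono[OF abs_ge_self[of L] nonneg[OF that]] by linarith
  have Sn: "dual_norm V N (adjoint_on V (S k) m) \<le> \<bar>L\<bar> * dual_norm V N m" if "m \<in> X" for k m
    using that XD S(2)
    by (intro adjoint_on_dual[OF seminormed_subspace_axioms seminormed_subspace_axioms S(1) _ _ S']) auto
  \<comment> \<open>The roles cross over: the adjoints of the \<open>T k\<close> form the projection
    \<open>P\<close>, while those of the \<open>S k\<close>, summed over \<open>k\<close>, form the
    embedding \<open>J\<close>.\<close>
  define P where "P = (\<lambda>m k. adjoint_on V (T k) m)"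
  define R where "R = (\<lambda>u k. adjoint_on V (S k) (u k))"
  define J where "J = (\<lambda>u v. \<Sum>n. R u n v)"
  have bP: "bounded_linear_on X (dual_norm V N) ?Y ?NY P"
  proof -
    have *: "summable (\<lambda>k. dual_norm V N (P m k)) \<and> (\<Sum>k. dual_norm V N (P m k)) \<le> K * dual_norm V N m"
      if m: "m \<in> X" for m
    proof -
      have le: "(\<Sum>k<n. dual_norm V N (P m k)) \<le> K * dual_norm V N m" for n
        unfolding P_def using T m XD
        by (intro sum_dual_norm_adjoint_le) auto
      have nn: "0 \<le> dual_norm V N (P m k)" for k
        unfolding P_def by (intro X.nonneg T(3) m)
      from summableI_nonneg_bounded[OF nn le] suminf_le_const[OF _ le] show ?thesis by blast
    qed
    show ?thesis
    proof (rule bounded_linear_onI[OF _ _ K0])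
      show "linear_on X P"
        unfolding P_def by (auto simp: linear_on_def adjoint_on_def fun_eq_iff)
      show "P m \<in> ?Y" if "m \<in> X" for m
        using * that T(3) by (auto simp: X.l1_sum_iff P_def)
      show "?NY (P m) \<le> K * dual_norm V N m" if "m \<in> X" for m
        using * that by (simp add: l1_sum_norm_def)
    qed
  qed
  have bR: "bounded_linear_on ?Y ?NY ?Y ?NY R"
  proof (rule bounded_linear_onI[where K = "\<bar>L\<bar>"])
    have *: "R u \<in> ?Y \<and> ?NY (R u) \<le> \<bar>L\<bar> * ?NY u" if "u \<in> ?Y" for u
      using X.l1_sum_norm_bound[of "R u" "\<lambda>n. \<bar>L\<bar> * dual_norm V N (u n)"] that Sn S(3)
      by (auto simp: X.l1_sum_iff l1_sum_norm_def R_def suminf_mult summable_mult)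
    then show "R u \<in> ?Y" "?NY (R u) \<le> \<bar>L\<bar> * ?NY u" if "u \<in> ?Y" for u
      using that by auto
    show "linear_on ?Y R"
      by (auto simp: linear_on_def R_def adjoint_on_def fun_eq_iff)
  qed auto
  have bJ: "bounded_linear_on ?Y ?NY X (dual_norm V N) J"
    unfolding J_def using bounded_linear_on_compose[OF bR bounded_linear_on_l1_suminf[OF A, folded X_def]] .
  show ?thesis
  proof (rule X.linearly_isomorphic_l1_sum_if_complemented[OF bJ bP])
    fix u assume u: "u \<in> ?Y"
    show "P (J u) = u"
    proof (intro ext)
      fix k v
      have uD: "u n \<in> dual_space V N" for n using u XD by (auto simp: X.l1_sum_iff)
      have u0: "u n 0 = 0" for n
        by (rule linear_on_0[OF dual_space_linear[OF uD] subspace])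
      show "P (J u) k v = u k v"
      proof (cases "v \<in> V")
        case True
        then have "P (J u) k v = (\<Sum>n. u n (S n (T k v)))"
          using T(2) by (simp add: P_def J_def R_def adjoint_on_def)
        \<comment> \<open>By \<open>ST\<close> all terms but the one of index \<open>k\<close> are
          \<open>u n 0\<close>, which is zero by linearity.\<close>
        also have "\<dots> = (\<Sum>n\<in>{k}. u n (S n (T k v)))"
          by (rule suminf_finite) (auto simp: ST True u0)
        finally show ?thesis by (simp add: ST True)
      qed (simp add: P_def adjoint_on_def dual_space_outside[OF uD])
    qed
  qed
qed

end


section \<open>Lipschitz-free spaces\<close>

text \<open>Induction on \<open>F\<close> with \<open>V\<close> varying: passing to the kernel of
  \<open>m\<close> in \<open>V\<close> removes \<open>m\<close> from the family, and the coefficient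
  of \<open>m\<close> is recovered from one vector \<open>u\<close> with
  \<open>m u = 1\<close>.\<close>

lemma kernel_subset_imp_combination:
  fixes \<phi> :: "'v::real_vector \<Rightarrow> real"
  assumes "finite F" "subspace V" "linear_on V \<phi>" "\<And>m. m \<in> F \<Longrightarrow> linear_on V m"
    and "\<And>v. v \<in> V \<Longrightarrow> (\<And>m. m \<in> F \<Longrightarrow> m v = 0) \<Longrightarrow> \<phi> v = 0"
  shows "\<exists>c. \<forall>v\<in>V. \<phi> v = (\<Sum>m\<in>F. c m * m v)"
  using assms
proof (induction F arbitrary: V rule: finite_induct)
  case empty
  then show ?case by simp
next
  case (insert m F)
  let ?W = "{v\<in>V. m v = 0}"
  have m: "linear_on V m" using insert.prems by simp
  have W: "subspace ?W"
    using insert.prems(1) linear_onD[OF m] linear_on_0[OF m insert.prems(1)]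
    by (auto simp: subspace_def)
  have "\<exists>c. \<forall>v\<in>?W. \<phi> v = (\<Sum>m\<in>F. c m * m v)"
    using insert.prems linear_on_subset[of V _ ?W] by (intro insert.IH W) auto
  then obtain c where c: "\<And>v. v \<in> V \<Longrightarrow> m v = 0 \<Longrightarrow> \<phi> v = (\<Sum>m\<in>F. c m * m v)"
    by auto
  show ?case
  proof (cases "\<forall>v\<in>V. m v = 0")
    case True
    then show ?thesis
      using c insert.hyps by (intro exI[of _ c]) simp
  next
    case False
    then obtain w where w: "w \<in> V" "m w \<noteq> 0" by auto
    define u where "u = inverse (m w) *\<^sub>R w"
    have u: "u \<in> V" "m u = 1"
      using w linear_onD(2)[OF m w(1)] insert.prems(1) by (auto simp: u_def subspace_scale)
    \<comment> \<open>The coefficient forced by requiring the identity at \<open>u\<close>.\<close>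
    define d where "d = \<phi> u - (\<Sum>m\<in>F. c m * m u)"
    have "\<phi> v = (\<Sum>p\<in>insert m F. (c(m := d)) p * p v)" if v: "v \<in> V" for v
    proof -
      have mu: "m v *\<^sub>R u \<in> V" using u insert.prems(1) by (simp add: subspace_scale)
      have lin: "p (v - m v *\<^sub>R u) = p v - m v * p u" if "linear_on V p" for p :: "'v \<Rightarrow> real"
        using linear_on_diff[OF that insert.prems(1) v mu] linear_onD(2)[OF that u(1)] by simp
      have "\<phi> (v - m v *\<^sub>R u) = (\<Sum>p\<in>F. c p * p (v - m v *\<^sub>R u))"
        using v mu insert.prems(1) u by (intro c) (auto simp: subspace_diff lin[OF m])
      also have "\<dots> = (\<Sum>p\<in>F. c p * (p v - m v * p u))"
        using insert.prems(3) by (intro sum.cong) (auto simp: lin)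
      finally have "\<phi> v = m v * d + (\<Sum>p\<in>F. c p * p v)"
        using lin[OF insert.prems(2)]
        by (simp add: d_def algebra_simps sum_subtractf sum_distrib_left)
      moreover have "(\<Sum>p\<in>F. (c(m := d)) p * p v) = (\<Sum>p\<in>F. c p * p v)"
        using insert.hyps by (intro sum.cong) auto
      ultimately show ?thesis using insert.hyps by simp
    qed
    then show ?thesis by blast
  qed
qed

section \<open>Lipschitz functions, point evaluations and the free space\<close>

lemma lip_norm_le: "L-lipschitz_on S f \<Longrightarrow> lip_norm S f \<le> L"
  unfolding lip_norm_def
  by (rule cInf_lower) (auto intro!: bdd_belowI[of _ 0] lipschitz_on_nonneg)

text \<open>The infimum is attained, because every difference quotient is a lower bound for the
  admissible constants.\<close>

lemma lipschitz_on_lip_norm: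
  fixes f :: "'a::metric_space \<Rightarrow> real"
  assumes "L-lipschitz_on S f"
  shows "(lip_norm S f)-lipschitz_on S f"
proof (rule lipschitz_onI)
  have ne: "{L. L-lipschitz_on S f} \<noteq> {}" using assms by auto
  show "0 \<le> lip_norm S f"
    unfolding lip_norm_def using ne lipschitz_on_nonneg by (intro cInf_greatest) auto
  fix x y assume xy: "x \<in> S" "y \<in> S"
  show "dist (f x) (f y) \<le> lip_norm S f * dist x y"
  proof (cases "x = y")
    case False
    have "dist (f x) (f y) / dist x y \<le> lip_norm S f"
      unfolding lip_norm_def
      using ne xy False lipschitz_onD[of _ S f x y] by (intro cInf_greatest) (auto simp: divide_le_eq)
    with False show ?thesis by (simp add: divide_le_eq)
  qed simp
qed

lemma lip0_lipschitz: "f \<in> lip0 b S \<Longrightarrow> (lip_norm S f)-lipschitz_on S f"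
  by (auto simp: lip0_def intro: lipschitz_on_lip_norm)

lemma lip0_dist_le: "f \<in> lip0 b S \<Longrightarrow> x \<in> S \<Longrightarrow> y \<in> S \<Longrightarrow> \<bar>f x - f y\<bar> \<le> lip_norm S f * dist x y"
  using lipschitz_onD[OF lip0_lipschitz] by (simp add: dist_real_def)

lemma lip0_base: "f \<in> lip0 b S \<Longrightarrow> f b = 0"
  by (simp add: lip0_def)

lemma seminormed_lip0: "seminormed_subspace (lip0 b S) (lip_norm S)"
proof
  have add: "(lip_norm S f + lip_norm S g)-lipschitz_on S (f + g)"
    if "f \<in> lip0 b S" "g \<in> lip0 b S" for f g
    using lipschitz_on_add[OF lip0_lipschitz[OF that(1)] lip0_lipschitz[OF that(2)]]
    by (simp add: plus_fun_def)
  have scale: "(\<bar>c\<bar> * lip_norm S f)-lipschitz_on S (c *\<^sub>R f)" if "f \<in> lip0 b S" for c f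
    using lipschitz_on_cmult[OF lip0_lipschitz[OF that], of c] by (simp add: scaleR_fun_def)
  show "subspace (lip0 b S)"
  proof (rule subspaceI)
    show "0 \<in> lip0 b S" by (auto simp: lip0_def zero_fun_def intro: lipschitz_on_constant)
    show "f + g \<in> lip0 b S" if "f \<in> lip0 b S" "g \<in> lip0 b S" for f g
      using that add[OF that] by (auto simp: lip0_def)
    show "c *\<^sub>R f \<in> lip0 b S" if "f \<in> lip0 b S" for c f
      using that scale[OF that] by (auto simp: lip0_def)
  qed
  show "lip_norm S (f + g) \<le> lip_norm S f + lip_norm S g"
    if "f \<in> lip0 b S" "g \<in> lip0 b S" for f g
    using lip_norm_le[OF add[OF that]] .
  show "lip_norm S (c *\<^sub>R f) \<le> \<bar>c\<bar> * lip_norm S f" if "f \<in> lip0 b S" for c f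
    using lip_norm_le[OF scale[OF that]] .
qed

lemma delta_in_dual_space:
  assumes "b \<in> S" "x \<in> S"
  shows "delta b S x \<in> dual_space (lip0 b S) (lip_norm S)"
proof -
  interpret L: seminormed_subspace "lip0 b S" "lip_norm S" by (rule seminormed_lip0)
  show ?thesis
  proof (rule L.dual_spaceI)
    show "linear_on (lip0 b S) (delta b S x)"
      by (simp add: linear_on_def delta_def L.mem_add L.mem_scale)
    show "\<bar>delta b S x f\<bar> \<le> dist x b * lip_norm S f" if "f \<in> lip0 b S" for f
      using lip0_dist_le[OF that assms(2,1)] lip0_base[OF that] that by (simp add: delta_def mult.commute)
  qed (simp add: delta_def)
qed

lemma span_delta_subset:
  assumes "b \<in> S"
  shows "span (delta b S ` S) \<subseteq> dual_space (lip0 b S) (lip_norm S)"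
proof -
  interpret L: seminormed_subspace "lip0 b S" "lip_norm S" by (rule seminormed_lip0)
  interpret D: seminormed_subspace "dual_space (lip0 b S) (lip_norm S)" "free_norm b S"
    by (rule L.seminormed_dual_space)
  show ?thesis
    using delta_in_dual_space[OF assms] by (intro span_minimal D.subspace) auto
qed

lemma seminormed_free_space:
  assumes "b \<in> S"
  shows "seminormed_subspace (free_space b S) (free_norm b S)"
  unfolding free_space_def
  by (intro seminormed_subspace.seminormed_norm_closure seminormed_subspace.seminormed_dual_space
      seminormed_lip0 span_delta_subset assms) simp

lemma span_delta_in_free_space:
  assumes "b \<in> S"
  shows "span (delta b S ` S) \<subseteq> free_space b S"
  unfolding free_space_def
  by (intro seminormed_subspace.subset_norm_closure seminormed_subspace.seminormed_dual_space
      seminormed_lip0 span_delta_subset assms)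

lemma delta_in_free_space: "b \<in> S \<Longrightarrow> x \<in> S \<Longrightarrow> delta b S x \<in> free_space b S"
  using span_delta_in_free_space by (blast intro: span_base)

lemma free_space_linear: "m \<in> free_space b S \<Longrightarrow> linear_on (lip0 b S) m"
  by (auto simp: free_space_def norm_closure_def dual_space_def)

text \<open>The criterion that every operator on functions has to pass: point evaluations span a
  dense subspace, so it is enough to follow them through the adjoint.\<close>

lemma adjoint_on_free_space:
  assumes "b \<in> S" "c \<in> R"
    and T: "bounded_linear_on (lip0 b S) (lip_norm S) (lip0 c R) (lip_norm R) T"
    and delta: "\<And>x. x \<in> R \<Longrightarrow> adjoint_on (lip0 b S) T (delta c R x) \<in> free_space b S"
    and m: "m \<in> free_space c R"
  shows "adjoint_on (lip0 b S) T m \<in> free_space b S"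
  unfolding free_space_def
proof (rule adjoint_on_norm_closure[OF seminormed_lip0 seminormed_lip0 T])
  show "delta c R ` R \<subseteq> dual_space (lip0 c R) (lip_norm R)"
    using delta_in_dual_space[OF assms(2)] by blast
  show "span (delta b S ` S) \<subseteq> dual_space (lip0 b S) (lip_norm S)"
    by (rule span_delta_subset[OF assms(1)])
  show "m \<in> norm_closure (dual_space (lip0 c R) (lip_norm R)) (free_norm c R) (span (delta c R ` R))"
    using m by (simp add: free_space_def)
  show "adjoint_on (lip0 b S) T a \<in> norm_closure (dual_space (lip0 b S) (lip_norm S)) (free_norm b S) (span (delta b S ` S))"
    if "a \<in> delta c R ` R" for a
    using that delta by (auto simp: free_space_def)
qed simp

section \<open>The weak-star topology and its continuous functionals\<close>

lemma topspace_weak_star: "topspace (weak_star b S) = lip0 b S"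
  by (auto simp: weak_star_def topspace_pullback_topology)

lemma continuous_map_weak_star_eval:
  assumes "m \<in> free_space b S"
  shows "continuous_map (weak_star b S) euclideanreal m"
proof -
  have "continuous_map (weak_star b S) euclideanreal ((\<lambda>u. u m) \<circ> (\<lambda>f. \<lambda>m\<in>free_space b S. m f))"
    unfolding weak_star_def
    by (intro continuous_map_pullback continuous_map_product_projection assms)
  then show ?thesis using assms by (simp add: o_def)
qed

text \<open>A basic neighbourhood of \<open>0\<close> restricts only finitely many evaluations. On
  their common kernel the functional stays below 1 in absolute value, hence vanishes, hence is a
  combination of these evaluations.\<close>

lemma weak_star_continuous_functional:
  assumes "continuous_map (weak_star b S) euclideanreal \<phi>" "linear_on (lip0 b S) \<phi>"
  shows "\<exists>F c. finite F \<and> F \<subseteq> free_space b S \<and> (\<forall>f\<in>lip0 b S. \<phi> f = (\<Sum>m\<in>F. c m * m f))"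
proof -
  interpret L: seminormed_subspace "lip0 b S" "lip_norm S" by (rule seminormed_lip0)
  let ?r = "\<lambda>f. \<lambda>m\<in>free_space b S. m f"
  have "openin (weak_star b S) {f \<in> topspace (weak_star b S). \<phi> f \<in> {-1<..<1}}"
    by (rule openin_continuous_map_preimage[OF assms(1)]) simp
  then obtain O' where O': "openin (product_topology (\<lambda>_. euclideanreal) (free_space b S)) O'"
      "{f \<in> lip0 b S. \<phi> f \<in> {-1<..<1}} = ?r -` O' \<inter> lip0 b S"
    unfolding topspace_weak_star by (auto simp: weak_star_def openin_pullback_topology)
  have "\<phi> 0 = 0" by (rule linear_on_0[OF assms(2) L.subspace])
  then have "0 \<in> ?r -` O' \<inter> lip0 b S" using L.mem_0 O'(2) by force
  then have "?r 0 \<in> O'" by simp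
  with O'(1) obtain U where U: "finite {m \<in> free_space b S. U m \<noteq> UNIV}"
      "?r 0 \<in> Pi\<^sub>E (free_space b S) U" "Pi\<^sub>E (free_space b S) U \<subseteq> O'"
    unfolding openin_product_topology_alt by auto
  let ?F = "{m \<in> free_space b S. U m \<noteq> UNIV}"
  have small: "\<bar>\<phi> f\<bar> < 1" if f: "f \<in> lip0 b S" "\<And>m. m \<in> ?F \<Longrightarrow> m f = 0" for f
  proof -
    have "m f \<in> U m" if "m \<in> free_space b S" for m
    proof (cases "m \<in> ?F")
      case True
      have "m 0 = 0" by (rule linear_on_0[OF free_space_linear[OF that] L.subspace])
      then show ?thesis using f(2)[OF True] U(2) that by (auto simp: PiE_iff)
    qed (use that in auto)
    then have "?r f \<in> O'" using U(3) by (auto simp: PiE_iff subset_iff)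
    with f(1) O'(2) have "\<phi> f \<in> {-1<..<1}" by blast
    then show ?thesis by auto
  qed
  have "\<exists>c. \<forall>f\<in>lip0 b S. \<phi> f = (\<Sum>m\<in>?F. c m * m f)"
  proof (rule kernel_subset_imp_combination[OF U(1) L.subspace assms(2)])
    fix f assume f: "f \<in> lip0 b S" "\<And>m. m \<in> ?F \<Longrightarrow> m f = 0"
    show "\<phi> f = 0"
    proof (rule ccontr)
      assume *: "\<phi> f \<noteq> 0"
      \<comment> \<open>The common kernel is closed under scaling, and this multiple of
        \<open>f\<close> would have the value 1.\<close>
      have "\<bar>\<phi> (inverse (\<phi> f) *\<^sub>R f)\<bar> < 1"
      proof (rule small)
        show "inverse (\<phi> f) *\<^sub>R f \<in> lip0 b S" using f L.mem_scale by blast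
        show "m (inverse (\<phi> f) *\<^sub>R f) = 0" if "m \<in> ?F" for m
          using that f linear_onD(2)[OF free_space_linear[of m b S] f(1), of "inverse (\<phi> f)"]
          by simp
      qed
      then show False using * linear_onD(2)[OF assms(2) f(1), of "inverse (\<phi> f)"] by simp
    qed
  qed (auto intro: free_space_linear)
  with U(1) show ?thesis by blast
qed

text \<open>Restates extendability for a prescribed base point \<open>b\<close> and for functions on
  all of \<open>M\<close>, with continuity turned into membership in the free space. Evaluation is
  written \<open>\<lambda>f. f z\<close> instead of \<open>delta\<close>, so that it applies to
  \<open>A f\<close> without a membership test.\<close>

lemma extension_operator:
  fixes b :: "'a::metric_space"
  assumes ext: "weak_star_lip_extendable C S (UNIV :: 'a set)" and "b \<in> S" "0 \<le> C"
  obtains A where "linear_on (lip0 b UNIV) A"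
    "\<And>f. f \<in> lip0 b UNIV \<Longrightarrow> A f b = 0"
    "\<And>f. f \<in> lip0 b UNIV \<Longrightarrow> (C * lip_norm UNIV f)-lipschitz_on UNIV (A f)"
    "\<And>f x. f \<in> lip0 b UNIV \<Longrightarrow> x \<in> S \<Longrightarrow> A f x = f x"
    "\<And>z. adjoint_on (lip0 b UNIV) A (\<lambda>f. f z) \<in> free_space b UNIV"
proof -
  obtain c E where c: "c \<in> S" and E: "linear_on (lip0 c S) E"
      "continuous_map (weak_star c S) (weak_star c UNIV) E"
      "\<And>f. f \<in> lip0 c S \<Longrightarrow> lip_norm UNIV (E f) \<le> C * lip_norm S f"
      "\<And>f x. f \<in> lip0 c S \<Longrightarrow> x \<in> S \<Longrightarrow> E f x = f x"
    using ext unfolding weak_star_lip_extendable_def by blast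
  interpret X: seminormed_subspace "free_space b UNIV" "free_norm b UNIV"
    by (rule seminormed_free_space) simp
  interpret L: seminormed_subspace "lip0 b UNIV" "lip_norm UNIV" by (rule seminormed_lip0)
  have E_mem: "E f \<in> lip0 c UNIV" if "f \<in> lip0 c S" for f
    using continuous_map_image_subset_topspace[OF E(2)] that by (auto simp: topspace_weak_star)
  \<comment> \<open>Restriction to \<open>S\<close>, renormalised at the base point \<open>c\<close>
    that comes with \<open>E\<close>; \<open>A\<close> adds \<open>f c\<close> back, so it agrees
    with \<open>f\<close> on \<open>S\<close> and in particular vanishes at
    \<open>b\<close>.\<close>
  define R where "R = (\<lambda>f x. if x \<in> S then f x - f c else (0::real))"
  have R_lip: "(lip_norm UNIV f)-lipschitz_on S (R f)" if "f \<in> lip0 b UNIV" for f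
  proof (rule lipschitz_onI)
    show "0 \<le> lip_norm UNIV f" by (rule L.nonneg[OF that])
  qed (use lip0_dist_le[OF that] in \<open>simp add: R_def dist_real_def\<close>)
  have R_mem: "R f \<in> lip0 c S" if "f \<in> lip0 b UNIV" for f
    using R_lip[OF that] c by (auto simp: lip0_def R_def)
  have bR: "bounded_linear_on (lip0 b UNIV) (lip_norm UNIV) (lip0 c S) (lip_norm S) R"
  proof (rule bounded_linear_onI[where K = 1])
    show "linear_on (lip0 b UNIV) R"
      by (auto simp: linear_on_def R_def fun_eq_iff algebra_simps)
    show "lip_norm S (R f) \<le> 1 * lip_norm UNIV f" if "f \<in> lip0 b UNIV" for f
      using lip_norm_le[OF R_lip[OF that]] by simp
  qed (use R_mem in auto)
  define A where "A = (\<lambda>f x. E (R f) x + f c)"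
  have A_S: "A f x = f x" if "f \<in> lip0 b UNIV" "x \<in> S" for f x
    using E(4)[OF R_mem[OF that(1)] that(2)] that(2) by (simp add: A_def R_def)
  have adj_R: "adjoint_on (lip0 b UNIV) R m \<in> free_space b UNIV" if "m \<in> free_space c S" for m
  proof (rule adjoint_on_free_space[OF UNIV_I c bR _ that])
    fix x assume "x \<in> S"
    then have "adjoint_on (lip0 b UNIV) R (delta c S x) = delta b UNIV x - delta b UNIV c"
      using R_mem by (auto simp: adjoint_on_def delta_def fun_eq_iff R_def)
    then show "adjoint_on (lip0 b UNIV) R (delta c S x) \<in> free_space b UNIV"
      by (simp add: X.mem_diff delta_in_free_space)
  qed
  show thesis
  proof (rule that)
    have "linear_on (lip0 b UNIV) (\<lambda>f. E (R f))"
      using linear_onD[OF bounded_linear_on_linear[OF bR]] linear_onD[OF E(1)] R_mem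
      by (simp add: linear_on_def)
    then show "linear_on (lip0 b UNIV) A"
      by (simp add: linear_on_def A_def fun_eq_iff algebra_simps)
    show "A f x = f x" if "f \<in> lip0 b UNIV" "x \<in> S" for f x by (rule A_S[OF that])
    show "A f b = 0" if "f \<in> lip0 b UNIV" for f using A_S[OF that \<open>b \<in> S\<close>] lip0_base[OF that] by simp
    show "(C * lip_norm UNIV f)-lipschitz_on UNIV (A f)" if f: "f \<in> lip0 b UNIV" for f
    proof -
      have "lip_norm UNIV (E (R f)) \<le> C * lip_norm S (R f)" by (rule E(3)[OF R_mem[OF f]])
      also have "\<dots> \<le> C * lip_norm UNIV f"
        by (intro mult_left_mono lip_norm_le R_lip f \<open>0 \<le> C\<close>)
      finally have "(C * lip_norm UNIV f)-lipschitz_on UNIV (E (R f))"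
        by (rule lipschitz_on_le[OF lip0_lipschitz[OF E_mem[OF R_mem[OF f]]]])
      then show ?thesis by (simp add: lipschitz_on_def A_def)
    qed
    fix z
    have eval: "delta c UNIV z (E f) = E f z" if "f \<in> lip0 c S" for f
      using E_mem[OF that] by (simp add: delta_def)
    have lin: "linear_on (lip0 c S) (\<lambda>f. E f z)"
      using E(1) by (auto simp: linear_on_def)
    have "continuous_map (weak_star c S) euclideanreal (delta c UNIV z \<circ> E)"
      by (intro continuous_map_compose[OF E(2)] continuous_map_weak_star_eval delta_in_free_space) auto
    then have "continuous_map (weak_star c S) euclideanreal (\<lambda>f. E f z)"
      by (rule continuous_map_eq) (simp add: eval topspace_weak_star)
    \<comment> \<open>Here the topology disappears: at the point \<open>z\<close> the extension is
      an exact finite combination, which \<open>R\<close> pulls back term by term.\<close>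
    then obtain F k where F: "finite F" "F \<subseteq> free_space c S"
        "\<And>f. f \<in> lip0 c S \<Longrightarrow> E f z = (\<Sum>m\<in>F. k m * m f)"
      using weak_star_continuous_functional[OF _ lin] by blast
    have "adjoint_on (lip0 b UNIV) A (\<lambda>f. f z) =
        (\<Sum>m\<in>F. k m *\<^sub>R adjoint_on (lip0 b UNIV) R m) + delta b UNIV c"
      using F(3)[OF R_mem] by (auto simp: fun_eq_iff adjoint_on_def delta_def A_def sum_fun_apply)
    then show "adjoint_on (lip0 b UNIV) A (\<lambda>f. f z) \<in> free_space b UNIV"
      using F(2) adj_R by (auto intro!: X.mem_add X.mem_sum X.mem_scale delta_in_free_space)
  qed
qed


section \<open>Dyadic annuli and disjoint balls\<close>

definition cutoff :: "'a::metric_space \<Rightarrow> nat \<Rightarrow> 'a \<Rightarrow> real"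
  where "cutoff b n x = max 0 (min 1 (2 - dist b x / 2 ^ n))"

definition annulus :: "'a::metric_space \<Rightarrow> nat \<Rightarrow> 'a \<Rightarrow> real"
  where "annulus b n x = cutoff b n x - (case n of 0 \<Rightarrow> 0 | Suc m \<Rightarrow> cutoff b m x)"

lemma cutoff_bounds: "0 \<le> cutoff b n x" "cutoff b n x \<le> 1"
  by (auto simp: cutoff_def)

lemma cutoff_eq_1: "dist b x \<le> 2 ^ n \<Longrightarrow> cutoff b n x = 1"
  by (simp add: cutoff_def)

lemma cutoff_eq_0: "2 ^ Suc n \<le> dist b x \<Longrightarrow> cutoff b n x = 0"
proof -
  assume "2 ^ Suc n \<le> dist b x"
  then have "2 \<le> dist b x / 2 ^ n" by (simp add: le_divide_eq)
  then show ?thesis by (simp add: cutoff_def)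
qed

lemma cutoff_diff_le: "\<bar>cutoff b n x - cutoff b n y\<bar> \<le> dist x y / 2 ^ n"
proof -
  have "\<bar>dist b x - dist b y\<bar> \<le> dist x y"
    by (metis abs_dist_diff_le dist_commute)
  then have "\<bar>dist b x / 2 ^ n - dist b y / 2 ^ n\<bar> \<le> dist x y / 2 ^ n"
    by (simp add: diff_divide_distrib[symmetric] divide_right_mono)
  then show ?thesis by (simp add: cutoff_def)
qed

lemma annulus_nonneg: "0 \<le> annulus b n x"
proof (cases n)
  case (Suc m)
  have "dist b x / 2 ^ Suc m \<le> dist b x / 2 ^ m" by (simp add: field_simps)
  then show ?thesis unfolding Suc annulus_def cutoff_def nat.case by linarith
qed (simp add: annulus_def cutoff_bounds)

lemma annulus_eq_0_far: "2 ^ Suc n \<le> dist b x \<Longrightarrow> annulus b n x = 0"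
proof (cases n)
  case (Suc m)
  assume *: "2 ^ Suc n \<le> dist b x"
  moreover have "(2::real) ^ Suc m \<le> 2 ^ Suc n" using Suc by simp
  ultimately have "2 ^ Suc m \<le> dist b x" by linarith
  then show ?thesis using cutoff_eq_0[OF *] cutoff_eq_0[of m b x] by (simp add: annulus_def Suc)
qed (simp add: annulus_def cutoff_eq_0)

lemma sum_annulus: "(\<Sum>n<Suc N. annulus b n x) = cutoff b N x"
  by (induction N) (simp_all add: annulus_def)

lemma sum_annulus_le_1: "(\<Sum>n<N. annulus b n x) \<le> 1"
  using sum_annulus[of b x] cutoff_bounds(2)[of b] by (cases N) auto

text \<open>An index from which on all annuli vanish at \<open>x\<close>, so that a finite sum of
  point-dependent length stands for the infinite one. The crude estimate
  \<open>d \<le> n \<le> 2 ^ n\<close> takes the place of a logarithm.\<close>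

definition level :: "'a::metric_space \<Rightarrow> 'a \<Rightarrow> nat"
  where "level b x = Suc (nat \<lceil>dist b x\<rceil>)"

lemma dist_le_pow_level: "level b x \<le> Suc n \<Longrightarrow> dist b x \<le> 2 ^ n"
proof -
  assume "level b x \<le> Suc n"
  then have "dist b x \<le> real n" unfolding level_def by linarith
  also have "\<dots> \<le> 2 ^ n" using of_nat_less_two_power[of n] by (simp add: less_imp_le)
  finally show ?thesis .
qed

lemma annulus_eq_0_near:
  assumes "level b x \<le> n"
  shows "annulus b n x = 0"
proof -
  obtain m where m: "n = Suc m" using assms by (cases n) (auto simp: level_def)
  have "dist b x \<le> 2 ^ m" "dist b x \<le> 2 ^ Suc m"
    using assms m dist_le_pow_level[of b x m] dist_le_pow_level[of b x "Suc m"] by simp_all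
  then show ?thesis by (simp add: annulus_def m cutoff_eq_1 del: power_Suc)
qed

lemma sum_annulus_level: "(\<Sum>n<level b x. annulus b n x) = 1"
  using sum_annulus[of b x "nat \<lceil>dist b x\<rceil>"] cutoff_eq_1[of b x] dist_le_pow_level[of b x]
  by (simp add: level_def)

lemma sum_annulus_extend:
  assumes "level b x \<le> N"
  shows "(\<Sum>n<N. annulus b n x * g n) = (\<Sum>n<level b x. annulus b n x * g n)"
  using assms by (intro sum.mono_neutral_right) (auto simp: annulus_eq_0_near not_less)

text \<open>The first surviving term is below 2 and each later one is half its predecessor.\<close>

lemma sum_geometric_tail_le:
  assumes "0 \<le> t"
  shows "(\<Sum>n<N. if 2 ^ Suc n \<le> t then 0 else t / 2 ^ n) \<le> (4::real)"
proof -
  \<comment> \<open>For the induction the bound is sharpened by the rest of the series: the terms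
    from index \<open>N\<close> on would add up to \<open>2 * t / 2 ^ N\<close>.\<close>
  have "(\<Sum>n<N. if 2 ^ Suc n \<le> t then 0 else t / 2 ^ n) \<le> (if 2 ^ N \<le> t then 0 else 4 - 2 * t / 2 ^ N)"
  proof (induction N)
    case (Suc N)
    show ?case
    proof (cases "2 ^ N \<le> t")
      case True
      show ?thesis
      proof (cases "2 ^ Suc N \<le> t")
        case False
        then have "t / 2 ^ N \<le> 2" by (simp add: divide_le_eq)
        then show ?thesis using Suc.IH True False by simp
      qed (use Suc.IH True in simp)
    next
      case False
      then have "\<not> 2 ^ Suc N \<le> t" using assms by simp
      moreover have "2 * t / 2 ^ Suc N = t / 2 ^ N" "2 * t / 2 ^ N = 2 * (t / 2 ^ N)" by simp_all
      ultimately show ?thesis using Suc.IH False by simp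
    qed
  qed (use assms in auto)
  also have "\<dots> \<le> 4" using assms by simp
  finally show ?thesis .
qed

text \<open>Cut-offs with \<open>2 ^ Suc n \<le> dist b y\<close> vanish at both points, since
  \<open>y\<close> is the nearer one; the others have slope \<open>1 / 2 ^ n\<close> and leave a
  geometric tail of at most 4. Each cut-off enters two consecutive annuli, whence 8.\<close>

lemma sum_abs_annulus_diff_le:
  assumes "dist b y \<le> dist b x"
  shows "(\<Sum>n<N. \<bar>annulus b n x - annulus b n y\<bar>) * dist b y \<le> 8 * dist x y"
proof -
  let ?d = "\<lambda>n. \<bar>cutoff b n x - cutoff b n y\<bar>"
  have "(\<Sum>n<N. \<bar>annulus b n x - annulus b n y\<bar>) \<le> 2 * (\<Sum>n<N. ?d n)"
  proof -
    have "(\<Sum>n<N. \<bar>annulus b n x - annulus b n y\<bar>) \<le> (\<Sum>n<N. ?d n) + (\<Sum>n<N. case n of 0 \<Rightarrow> 0 | Suc m \<Rightarrow> ?d m)"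
      unfolding sum.distrib[symmetric]
      by (intro sum_mono) (auto simp: annulus_def split: nat.split)
    moreover have "(\<Sum>n<N. case n of 0 \<Rightarrow> 0 | Suc m \<Rightarrow> ?d m) \<le> (\<Sum>n<N. ?d n)"
    proof (cases N)
      case (Suc M)
      then have "(\<Sum>n<N. case n of 0 \<Rightarrow> 0 | Suc m \<Rightarrow> ?d m) = (\<Sum>n<M. ?d n)"
        by (simp add: sum.lessThan_Suc_shift del: sum.lessThan_Suc)
      then show ?thesis using Suc by simp
    qed simp
    ultimately show ?thesis by simp
  qed
  then have "(\<Sum>n<N. \<bar>annulus b n x - annulus b n y\<bar>) * dist b y \<le> 2 * (\<Sum>n<N. ?d n) * dist b y"
    by (rule mult_right_mono) simp
  also have "\<dots> = 2 * (\<Sum>n<N. ?d n * dist b y)"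
    by (simp add: sum_distrib_right)
  also have "(\<Sum>n<N. ?d n * dist b y) \<le>
      (\<Sum>n<N. (if 2 ^ Suc n \<le> dist b y then 0 else dist b y / 2 ^ n) * dist x y)"
  proof (rule sum_mono)
    fix n
    show "?d n * dist b y \<le> (if 2 ^ Suc n \<le> dist b y then 0 else dist b y / 2 ^ n) * dist x y"
    proof (cases "2 ^ Suc n \<le> dist b y")
      case True
      then show ?thesis using assms cutoff_eq_0[of n b x] cutoff_eq_0[of n b y] by simp
    next
      case False
      then show ?thesis
        using mult_right_mono[OF cutoff_diff_le[of b n x y], of "dist b y"] by (simp add: mult.commute)
    qed
  qed
  also have "\<dots> \<le> 4 * dist x y"
    unfolding sum_distrib_right[symmetric] by (intro mult_right_mono sum_geometric_tail_le) auto
  finally show ?thesis by simp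
qed

text \<open>Product rule: varying \<open>g n\<close> costs 1, as the weights sum to at most 1;
  varying the weights costs 8, with \<open>g n\<close> taken at the point nearer to
  \<open>b\<close>, where it is at most \<open>L * dist b y\<close>.\<close>

lemma annulus_sum_lipschitz:
  fixes g :: "nat \<Rightarrow> 'a::metric_space \<Rightarrow> real"
  assumes g: "\<And>n. L-lipschitz_on UNIV (g n)" "\<And>n. g n b = 0"
  shows "(9 * L)-lipschitz_on UNIV (\<lambda>x. \<Sum>n<level b x. annulus b n x * g n x)"
proof -
  have L: "0 \<le> L" using g(1) lipschitz_on_nonneg by blast
  have gd: "\<bar>g n x - g n y\<bar> \<le> L * dist x y" for n x y
    using lipschitz_onD[OF g(1)] by (simp add: dist_real_def)
  have *: "\<bar>(\<Sum>n<N. annulus b n x * g n x) - (\<Sum>n<N. annulus b n y * g n y)\<bar> \<le> 9 * L * dist x y"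
    if le: "dist b y \<le> dist b x" for x y N
  proof -
    have gy: "\<bar>g n y\<bar> \<le> L * dist b y" for n
      using gd[of n b y] g(2)[of n] by simp
    have "(\<Sum>n<N. annulus b n x * g n x) - (\<Sum>n<N. annulus b n y * g n y)
        = (\<Sum>n<N. annulus b n x * (g n x - g n y)) + (\<Sum>n<N. (annulus b n x - annulus b n y) * g n y)"
      by (simp add: sum_subtractf[symmetric] sum.distrib[symmetric] algebra_simps)
    moreover have "\<bar>\<Sum>n<N. annulus b n x * (g n x - g n y)\<bar> \<le> 1 * (L * dist x y)"
    proof -
      have "\<bar>\<Sum>n<N. annulus b n x * (g n x - g n y)\<bar> \<le> (\<Sum>n<N. annulus b n x * (L * dist x y))"
        using gd annulus_nonneg
        by (intro order_trans[OF sum_abs] sum_mono) (simp add: abs_mult abs_of_nonneg[OF annulus_nonneg] mult_left_mono[OF gd annulus_nonneg])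
      also have "\<dots> \<le> 1 * (L * dist x y)"
        unfolding sum_distrib_right[symmetric] using L by (intro mult_right_mono sum_annulus_le_1) simp
      finally show ?thesis .
    qed
    moreover have "\<bar>\<Sum>n<N. (annulus b n x - annulus b n y) * g n y\<bar> \<le> L * (8 * dist x y)"
    proof -
      have "\<bar>\<Sum>n<N. (annulus b n x - annulus b n y) * g n y\<bar>
          \<le> (\<Sum>n<N. \<bar>annulus b n x - annulus b n y\<bar> * (L * dist b y))"
        using gy by (intro order_trans[OF sum_abs] sum_mono) (simp add: abs_mult mult_left_mono)
      also have "\<dots> = L * ((\<Sum>n<N. \<bar>annulus b n x - annulus b n y\<bar>) * dist b y)"
        by (simp add: sum_distrib_left mult_ac)
      also have "\<dots> \<le> L * (8 * dist x y)"
        by (intro mult_left_mono sum_abs_annulus_diff_le le L)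
      finally show ?thesis .
    qed
    ultimately show ?thesis by linarith
  qed
  show ?thesis
  proof (rule lipschitz_onI)
    fix x y
    \<comment> \<open>The two sums have different lengths; padding both with zeros to length
      \<open>N\<close> makes them comparable.\<close>
    obtain N where N: "level b x \<le> N" "level b y \<le> N"
      using max.cobounded1 max.cobounded2 by blast
    have "\<bar>(\<Sum>n<N. annulus b n x * g n x) - (\<Sum>n<N. annulus b n y * g n y)\<bar> \<le> 9 * L * dist x y"
    proof (cases "dist b y \<le> dist b x")
      case False
      then have "dist b x \<le> dist b y" by simp
      from *[OF this, of N] show ?thesis
        by (subst abs_minus_commute) (subst dist_commute)
    qed (rule *)
    then show "dist (\<Sum>n<level b x. annulus b n x * g n x) (\<Sum>n<level b y. annulus b n y * g n y)
        \<le> 9 * L * dist x y"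
      by (simp only: dist_real_def sum_annulus_extend[OF N(1)] sum_annulus_extend[OF N(2)])
  qed (use L in simp)
qed

section \<open>Cutting off, gluing and separating\<close>

lemma cutoff_mult_lipschitz:
  fixes g :: "'a::metric_space \<Rightarrow> real"
  assumes g: "L-lipschitz_on UNIV g" "g b = 0"
  shows "(3 * L)-lipschitz_on UNIV (\<lambda>x. cutoff b n x * g x)"
proof -
  have L: "0 \<le> L" using g(1) lipschitz_on_nonneg by blast
  have gd: "\<bar>g x - g y\<bar> \<le> L * dist x y" for x y
    using lipschitz_onD[OF g(1)] by (simp add: dist_real_def)
  have *: "\<bar>cutoff b n x * g x - cutoff b n y * g y\<bar> \<le> 3 * L * dist x y"
    if "dist b y \<le> 2 ^ Suc n" for x y
  proof -
    \<comment> \<open>Varying \<open>g\<close> costs 1. Varying the cut-off costs 2, its slope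
      \<open>1 / 2 ^ n\<close> times the bound \<open>L * 2 ^ Suc n\<close> for \<open>g\<close> at
      \<open>y\<close>.\<close>
    have "cutoff b n x * g x - cutoff b n y * g y =
        cutoff b n x * (g x - g y) + (cutoff b n x - cutoff b n y) * g y"
      by (simp add: algebra_simps)
    moreover have "\<bar>cutoff b n x * (g x - g y)\<bar> \<le> 1 * (L * dist x y)"
      unfolding abs_mult using cutoff_bounds[of b n x] by (intro mult_mono gd) auto
    moreover have "\<bar>(cutoff b n x - cutoff b n y) * g y\<bar> \<le> dist x y / 2 ^ n * (L * 2 ^ Suc n)"
    proof -
      have "\<bar>g y\<bar> \<le> L * dist b y" using gd[of b y] g(2) by simp
      also have "\<dots> \<le> L * 2 ^ Suc n" by (rule mult_left_mono[OF that L])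
      finally show ?thesis
        unfolding abs_mult by (intro mult_mono cutoff_diff_le) auto
    qed
    moreover have "dist x y / 2 ^ n * (L * 2 ^ Suc n) = 2 * L * dist x y" by simp
    ultimately show ?thesis by linarith
  qed
  show ?thesis
  proof (rule lipschitz_onI)
    fix x y
    consider "dist b y \<le> 2 ^ Suc n" | "dist b x \<le> 2 ^ Suc n" |
      "2 ^ Suc n \<le> dist b x" "2 ^ Suc n \<le> dist b y" by linarith
    then show "dist (cutoff b n x * g x) (cutoff b n y * g y) \<le> 3 * L * dist x y"
    proof cases
      case 3
      then show ?thesis using L by (simp add: cutoff_eq_0)
    qed (use *[of y x] *[of x y] in \<open>simp_all add: dist_real_def dist_commute abs_minus_commute\<close>)
  qed (use L in simp)
qed

text \<open>If \<open>x\<close> lies in a piece that misses \<open>y\<close>, then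
  \<open>h i y = 0\<close>, so the value at \<open>x\<close> alone is at most
  \<open>M * dist x y\<close>; the same at \<open>y\<close> gives the factor 2, whatever the number
  of pieces.\<close>

lemma disjoint_union_lipschitz:
  fixes F :: "'a::metric_space \<Rightarrow> real"
  assumes h: "\<And>i. M-lipschitz_on UNIV (h i)" "\<And>i y. y \<notin> U i \<Longrightarrow> h i y = 0" and "0 \<le> M"
    and F: "\<And>i y. y \<in> U i \<Longrightarrow> F y = h i y" "\<And>y. (\<And>i. y \<notin> U i) \<Longrightarrow> F y = 0"
  shows "(2 * M)-lipschitz_on UNIV F"
proof (rule lipschitz_onI)
  fix x y
  have hd: "\<bar>h i x - h i y\<bar> \<le> M * dist x y" for i x y
    using lipschitz_onD[OF h(1)] by (simp add: dist_real_def)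
  show "dist (F x) (F y) \<le> 2 * M * dist x y"
  proof (cases "\<exists>i. x \<in> U i \<and> y \<in> U i")
    case True
    then obtain i where "x \<in> U i" "y \<in> U i" by blast
    then have "dist (F x) (F y) \<le> M * dist x y" using hd[of i x y] by (simp add: F dist_real_def)
    also have "\<dots> \<le> 2 * M * dist x y" using \<open>0 \<le> M\<close> by (intro mult_right_mono) auto
    finally show ?thesis .
  next
    case False
    have *: "\<bar>F x\<bar> \<le> M * dist x y" if "\<And>i. x \<in> U i \<Longrightarrow> y \<notin> U i" for x y
    proof (cases "\<exists>i. x \<in> U i")
      case True
      then obtain i where "x \<in> U i" by blast
      then show ?thesis using that[of i] hd[of i x y] by (simp add: F h(2))
    qed (use F(2) \<open>0 \<le> M\<close> in auto)
    have "\<bar>F x\<bar> \<le> M * dist x y" "\<bar>F y\<bar> \<le> M * dist x y"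
      using *[of x y] *[of y x] False by (auto simp: dist_commute)
    then show ?thesis by (simp add: dist_real_def)
  qed
qed (use \<open>0 \<le> M\<close> in simp)

text \<open>The balls lie in disjoint shells around \<open>b\<close>: each centre is taken farther
  out than the previous shell by more than the radius of its own ball.\<close>

lemma unbounded_disjoint_balls:
  fixes b :: "'a::metric_space" and r :: "nat \<Rightarrow> real"
  assumes "\<not> bounded (UNIV :: 'a set)" "\<And>i. 0 \<le> r i"
  obtains p where "\<And>i. b \<notin> cball (p i) (r i)"
    "\<And>i j. i \<noteq> j \<Longrightarrow> cball (p i) (r i) \<inter> cball (p j) (r j) = {}"
proof -
  have "\<exists>x. e < dist b x" for e
    using assms(1) unfolding bounded_any_center[where a = b] by (auto simp: not_le)
  then obtain far where far: "\<And>e. e < dist b (far e)" by metis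
  define p where "p = rec_nat (far (r 0)) (\<lambda>i q. far (dist b q + r i + r (Suc i)))"
  have p0: "r 0 < dist b (p 0)" and pS: "dist b (p i) + r i + r (Suc i) < dist b (p (Suc i))" for i
    using far by (simp_all add: p_def)
  have mono: "dist b (p i) + r i \<le> dist b (p j) + r j" if "i \<le> j" for i j
    using that
  proof (rule lift_Suc_mono_le[rotated])
    show "dist b (p n) + r n \<le> dist b (p (Suc n)) + r (Suc n)" for n
      using pS[of n] assms(2)[of "Suc n"] by linarith
  qed
  have sep: "dist b (p i) + r i + r j < dist b (p j)" if ij: "i < j" for i j
  proof -
    obtain k where k: "j = Suc k" using ij by (cases j) auto
    then show ?thesis using mono[of i k] pS[of k] ij by simp
  qed
  have disj: "cball (p i) (r i) \<inter> cball (p j) (r j) = {}" if "i < j" for i j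
  proof -
    have "dist (p i) (p j) \<ge> dist b (p j) - dist b (p i)"
      using dist_triangle[of b "p j" "p i"] by linarith
    with sep[OF that] have "r i + r j < dist (p i) (p j)" by linarith
    moreover have "dist (p i) (p j) \<le> dist (p i) z + dist (p j) z" for z
      by (rule dist_triangle2)
    ultimately have "z \<notin> cball (p i) (r i) \<or> z \<notin> cball (p j) (r j)" for z
      by (smt (verit) mem_cball)
    then show ?thesis by blast
  qed
  show thesis
  proof (rule that)
    show "cball (p i) (r i) \<inter> cball (p j) (r j) = {}" if "i \<noteq> j" for i j
      using that disj[of i j] disj[of j i] by (cases "i < j") (auto simp: not_less)
    show "b \<notin> cball (p i) (r i)" for i
    proof (cases i)
      case (Suc k)
      then show ?thesis using sep[of 0 i] p0 assms(2)[of 0] assms(2)[of i] by (simp add: dist_commute)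
    qed (use p0 in \<open>simp add: dist_commute\<close>)
  qed
qed


section \<open>The complemented copy of the \<open>\<ell>\<^sub>1\<close>-sum\<close>

theorem theorem3p2:
  fixes b :: "'a::metric_space" and C :: real
  assumes "homogeneous (UNIV :: 'a set)"
    and "\<not> bounded (UNIV :: 'a set)"
    and "1 \<le> C"
    and "\<And>(x::'a) r. 0 < r \<Longrightarrow> weak_star_lip_extendable C (cball x r) UNIV"
  shows "linearly_isomorphic (free_space b UNIV) (free_norm b UNIV)
    (l1_sum (free_space b UNIV) (free_norm b UNIV)) (l1_sum_norm (free_norm b UNIV))"
proof -
  let ?V = "lip0 b (UNIV :: 'a set)" and ?N = "lip_norm (UNIV :: 'a set)"
  let ?X = "free_space b (UNIV :: 'a set)"
  interpret V: seminormed_subspace ?V ?N by (rule seminormed_lip0)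
  interpret X: seminormed_subspace ?X "free_norm b UNIV" by (rule seminormed_free_space) simp

  \<comment> \<open>The ball of radius \<open>2 ^ Suc n\<close> contains every point where
    \<open>annulus b n\<close> is nonzero, so agreement with \<open>f\<close> on it is what the
    reconstruction in \<open>ST\<close> requires.\<close>
  have "\<forall>n::nat. \<exists>A. linear_on ?V A \<and> (\<forall>f\<in>?V. A f b = 0) \<and>
      (\<forall>f\<in>?V. (C * ?N f)-lipschitz_on UNIV (A f)) \<and>
      (\<forall>f\<in>?V. \<forall>x. dist b x \<le> 2 ^ Suc n \<longrightarrow> A f x = f x) \<and>
      (\<forall>z. adjoint_on ?V A (\<lambda>f. f z) \<in> ?X)"
  proof
    fix n :: nat
    have "weak_star_lip_extendable C (cball b (2 ^ Suc n)) (UNIV :: 'a set)" "b \<in> cball b (2 ^ Suc n)" "0 \<le> C"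
      using assms by auto
    from extension_operator[OF this] obtain A where A: "linear_on ?V A" "\<And>f. f \<in> ?V \<Longrightarrow> A f b = 0"
      "\<And>f. f \<in> ?V \<Longrightarrow> (C * ?N f)-lipschitz_on UNIV (A f)"
      "\<And>f x. f \<in> ?V \<Longrightarrow> x \<in> cball b (2 ^ Suc n) \<Longrightarrow> A f x = f x"
      "\<And>z. adjoint_on ?V A (\<lambda>f. f z) \<in> ?X" by metis
    then show "\<exists>A. linear_on ?V A \<and> (\<forall>f\<in>?V. A f b = 0) \<and>
      (\<forall>f\<in>?V. (C * ?N f)-lipschitz_on UNIV (A f)) \<and>
      (\<forall>f\<in>?V. \<forall>x. dist b x \<le> 2 ^ Suc n \<longrightarrow> A f x = f x) \<and>
      (\<forall>z. adjoint_on ?V A (\<lambda>f. f z) \<in> ?X)"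
      by (intro exI[of _ A]) auto
  qed
  then obtain A where A_lin: "\<And>n. linear_on ?V (A n)"
    and A_base: "\<And>n f. f \<in> ?V \<Longrightarrow> A n f b = 0"
    and A_lip: "\<And>n f. f \<in> ?V \<Longrightarrow> (C * ?N f)-lipschitz_on UNIV (A n f)"
    and A_eq: "\<And>(n::nat) f x. f \<in> ?V \<Longrightarrow> dist b x \<le> 2 ^ Suc n \<Longrightarrow> A n f x = f x"
    and A_adj: "\<And>n z. adjoint_on ?V (A n) (\<lambda>f. f z) \<in> ?X"
    by metis

  \<comment> \<open>A single sequence of balls serves all pairs of a summand \<open>k\<close> and a
    dyadic index \<open>n\<close>; \<open>snd (prod_decode i)\<close> recovers \<open>n\<close>. The
    radius \<open>2 ^ (n + 2)\<close> is where \<open>cutoff b (Suc n)\<close> reaches zero.\<close>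
  define e where "e = (\<lambda>k n. prod_encode (k, n))"
  have e_inj: "e k n = e k' n' \<longleftrightarrow> k = k' \<and> n = n'" for k n k' n' by (simp add: e_def)
  obtain p where p: "\<And>i. b \<notin> cball (p i) (2 ^ (snd (prod_decode i) + 2))"
    "\<And>i j. i \<noteq> j \<Longrightarrow> cball (p i) (2 ^ (snd (prod_decode i) + 2))
        \<inter> cball (p j) (2 ^ (snd (prod_decode j) + 2)) = {}"
    using unbounded_disjoint_balls[OF assms(2), where b = b and r = "\<lambda>i. 2 ^ (snd (prod_decode i) + 2)"]
    by auto
  have "\<forall>i. \<exists>h. bij h \<and> (\<forall>u v. dist (h u) (h v) = dist u v) \<and> h b = p i"
    using assms(1) unfolding homogeneous_def by blast
  then obtain h where h: "\<And>i. bij (h i)" "\<And>i u v. dist (h i u) (h i v) = dist u v" "\<And>i. h i b = p i"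
    by metis
  define \<phi> where "\<phi> = (\<lambda>k n. h (e k n))"
  define \<phi>' where "\<phi>' = (\<lambda>k n. inv (\<phi> k n))"
  define U where "U = (\<lambda>k n. cball (\<phi> k n b) (2 ^ (n + 2)))"
  have \<phi>_dist: "dist (\<phi> k n x) (\<phi> k n y) = dist x y" for k n x y by (simp add: \<phi>_def h)
  have \<phi>': "\<phi>' k n (\<phi> k n x) = x" "\<phi> k n (\<phi>' k n x) = x" for k n x
    using h(1)[of "e k n"] by (simp_all add: \<phi>'_def \<phi>_def bij_is_inj bij_is_surj surj_f_inv_f)
  have \<phi>'_dist: "dist (\<phi>' k n x) (\<phi>' k n y) = dist x y" for k n x y
    using \<phi>_dist[of k n "\<phi>' k n x" "\<phi>' k n y"] by (simp add: \<phi>')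
  have U_base: "b \<notin> U k n" for k n
    using p(1)[of "e k n"] h(3)[of "e k n"] by (simp add: U_def \<phi>_def e_def)
  have U_disj: "k = k' \<and> n = n'" if "x \<in> U k n" "x \<in> U k' n'" for k n k' n' x
  proof -
    have "x \<in> cball (p (e k n)) (2 ^ (snd (prod_decode (e k n)) + 2))
        \<inter> cball (p (e k' n')) (2 ^ (snd (prod_decode (e k' n')) + 2))"
      using that by (simp add: U_def \<phi>_def h(3)) (simp add: e_def)
    then have "e k n = e k' n'" using p(2) by blast
    then show ?thesis by (simp add: e_inj)
  qed
  have U_iff: "\<phi> k n x \<in> U k n \<longleftrightarrow> dist b x \<le> 2 ^ (n + 2)" for k n x
    by (simp add: U_def \<phi>_dist)

  \<comment> \<open>The cut-off is 1 on the ball where \<open>A n f\<close> equals \<open>f\<close>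
    and 0 outside the ball of twice that radius, so \<open>B n f\<close> can be transplanted to
    \<open>U k n\<close> and continued by zero.\<close>
  define B where "B = (\<lambda>n f x. cutoff b (Suc n) x * A n f x)"
  have B_lin: "linear_on ?V (B n)" for n
    using A_lin[of n] by (auto simp: linear_on_def B_def fun_eq_iff algebra_simps)
  have B_lip: "(3 * C * ?N f)-lipschitz_on UNIV (B n f)" if "f \<in> ?V" for n f
    using cutoff_mult_lipschitz[of "C * ?N f" "A n f" b "Suc n"] A_lip A_base that
    by (simp add: B_def mult.assoc)
  have B_outside: "B n f (\<phi>' k n y) = 0" if "y \<notin> U k n" for n f k y
  proof -
    have "2 ^ Suc (Suc n) \<le> dist b (\<phi>' k n y)"
      using that U_iff[of k n "\<phi>' k n y"] by (simp add: \<phi>')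
    then show ?thesis using cutoff_eq_0[of "Suc n" b] by (simp add: B_def)
  qed
  have B_eq: "B n f x = f x" if "f \<in> ?V" "dist b x \<le> 2 ^ Suc n" for n f x
    using A_eq[OF that] cutoff_eq_1[OF that(2)] by (simp add: B_def)
  have B\<phi>_lip: "M-lipschitz_on UNIV (\<lambda>y. B n f (\<phi>' k n y))"
    if "f \<in> ?V" "3 * C * ?N f \<le> M" for n f k M
    using lipschitz_on_le[OF B_lip[OF that(1)] that(2)] unfolding lipschitz_on_def
    by (metis UNIV_I \<phi>'_dist)

  \<comment> \<open>By disjointness the index set has at most one element; the sum selects the piece
    containing \<open>y\<close>, and yields 0 if there is none.\<close>
  define T where "T = (\<lambda>k f y. \<Sum>n\<in>{n. y \<in> U k n}. B n f (\<phi>' k n y))"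
  have U_single: "{n. y \<in> U k n} = {n}" if "y \<in> U k n" for y k n
    using that U_disj by blast
  have T_in: "T k f y = (if k = k' then B n f (\<phi>' k n y) else 0)" if "y \<in> U k' n" for k k' n f y
  proof (cases "k = k'")
    case False
    with that U_disj have "{n. y \<in> U k n} = {}" by blast
    with False show ?thesis by (simp add: T_def)
  qed (use U_single that in \<open>simp add: T_def\<close>)
  have T_out: "T k f y = 0" if "\<And>n. y \<notin> U k n" for k f y
    using that by (simp add: T_def)
  have T_lin: "linear_on ?V (T k)" for k
    using linear_onD[OF B_lin] by (auto simp: linear_on_def T_def fun_eq_iff sum.distrib sum_distrib_left)
  have T_lip: "(2 * (3 * C * ?N f))-lipschitz_on UNIV (T k f)" if f: "f \<in> ?V" for k f
    using assms(3) V.nonneg[OF f] T_in[of _ k] B_outside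
    by (intro disjoint_union_lipschitz[where h = "\<lambda>n y. B n f (\<phi>' k n y)" and U = "U k"]
        B\<phi>_lip f T_out) auto
  have T_mem: "T k f \<in> ?V" if f: "f \<in> ?V" for k f
    using T_lip[OF f, of k] T_out[of b k f] U_base by (auto simp: lip0_def)
  have T_norm: "?N (T k f) \<le> 6 * C * ?N f" if f: "f \<in> ?V" for k f
    using lip_norm_le[OF T_lip[OF f, of k]] by simp
  \<comment> \<open>At a fixed \<open>z\<close> only one piece contributes, and it is a scalar
    multiple of an evaluation of \<open>A n f\<close>.\<close>
  have T_adj: "adjoint_on ?V (T k) (delta b UNIV z) \<in> ?X" for k z
  proof (cases "\<exists>n. z \<in> U k n")
    case True
    then obtain n where n: "z \<in> U k n" by blast
    have "adjoint_on ?V (T k) (delta b UNIV z) =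
        cutoff b (Suc n) (\<phi>' k n z) *\<^sub>R adjoint_on ?V (A n) (\<lambda>f. f (\<phi>' k n z))"
      using T_mem T_in[OF n] by (auto simp: fun_eq_iff adjoint_on_def delta_def B_def)
    then show ?thesis using A_adj X.mem_scale by simp
  next
    case False
    then have "adjoint_on ?V (T k) (delta b UNIV z) = 0"
      using T_out by (auto simp: fun_eq_iff adjoint_on_def delta_def)
    then show ?thesis using X.mem_0 by simp
  qed
  \<comment> \<open>The \<open>U k n\<close> are disjoint over both indices, so the whole double
    family is glued in one go, with a constant independent of \<open>m\<close>.\<close>
  have T_sum: "?N (\<Sum>k<m. T k (f k)) \<le> 6 * C" if f: "\<And>k. f k \<in> ?V \<and> ?N (f k) \<le> 1" for m f
  proof -
    let ?h = "\<lambda>(k, n) y. if k < m then B n (f k) (\<phi>' k n y) else 0"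
    have "(2 * (3 * C))-lipschitz_on UNIV (\<Sum>k<m. T k (f k))"
    proof (rule disjoint_union_lipschitz[where h = ?h and U = "\<lambda>(k, n). U k n"])
      fix i :: "nat \<times> nat"
      obtain k n where i: "i = (k, n)" by fastforce
      have "3 * C * ?N (f k) \<le> 3 * C"
        using f[of k] assms(3) mult_left_mono[of "?N (f k)" 1 "3 * C"] by simp
      with f have "(3 * C)-lipschitz_on UNIV (\<lambda>y. B n (f k) (\<phi>' k n y))" by (intro B\<phi>_lip) auto
      then show "(3 * C)-lipschitz_on UNIV (?h i)"
        using assms(3) by (cases "k < m") (auto simp: i intro: lipschitz_on_le[OF lipschitz_on_constant])
      show "?h i y = 0" if "y \<notin> (case i of (k, n) \<Rightarrow> U k n)" for y
        using that B_outside by (simp add: i)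
      show "(\<Sum>k<m. T k (f k)) y = ?h i y" if "y \<in> (case i of (k, n) \<Rightarrow> U k n)" for y
      proof -
        have "(\<Sum>k<m. T k (f k)) y = (\<Sum>k'<m. if k' = k then B n (f k) (\<phi>' k n y) else 0)"
          using that T_in[of y k n] unfolding sum_fun_apply by (intro sum.cong) (auto simp: i)
        then show ?thesis by (simp add: i)
      qed
    next
      show "(\<Sum>k<m. T k (f k)) y = 0" if "\<And>i. y \<notin> (case i of (k, n) \<Rightarrow> U k n)" for y
        using that[of "(_, _)"] by (simp add: sum_fun_apply T_out)
    qed (use assms(3) in simp)
    then show ?thesis using lip_norm_le by fastforce
  qed

  \<comment> \<open>Subtracting the value at the centre of the copy makes the pulled-back functions
    vanish at \<open>b\<close>, as the bound for sums over annuli demands.\<close>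
  define S where "S = (\<lambda>k f x. \<Sum>n<level b x. annulus b n x * (f (\<phi> k n x) - f (\<phi> k n b)))"
  have S_lip: "(9 * ?N f)-lipschitz_on UNIV (S k f)" if f: "f \<in> ?V" for k f
    unfolding S_def
  proof (rule annulus_sum_lipschitz)
    show "(?N f)-lipschitz_on UNIV (\<lambda>x. f (\<phi> k n x) - f (\<phi> k n b))" for n
      using lip0_lipschitz[OF f] by (auto simp: lipschitz_on_def dist_real_def) (metis \<phi>_dist)
  qed simp
  have S_mem: "S k f \<in> ?V" if "f \<in> ?V" for k f
    using S_lip[OF that] by (auto simp: lip0_def S_def)
  have S_norm: "?N (S k f) \<le> 9 * ?N f" if "f \<in> ?V" for k f
    by (rule lip_norm_le[OF S_lip[OF that]])
  have S_lin: "linear_on ?V (S k)" for k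
    by (auto simp: linear_on_def S_def fun_eq_iff sum.distrib[symmetric] sum_distrib_left algebra_simps
        intro!: sum.cong)
  have S_adj: "adjoint_on ?V (S k) (delta b UNIV z) \<in> ?X" for k z
  proof -
    have "adjoint_on ?V (S k) (delta b UNIV z) =
        (\<Sum>n<level b z. annulus b n z *\<^sub>R (delta b UNIV (\<phi> k n z) - delta b UNIV (\<phi> k n b)))"
      using S_mem by (auto simp: fun_eq_iff adjoint_on_def delta_def S_def sum_fun_apply)
    then show ?thesis by (auto intro!: X.mem_sum X.mem_scale X.mem_diff delta_in_free_space)
  qed
  have ST: "S l (T k f) = (if k = l then f else 0)" if f: "f \<in> ?V" for k l f
  proof
    fix x
    have "annulus b n x * (T k f (\<phi> l n x) - T k f (\<phi> l n b)) = annulus b n x * (if k = l then f x else 0)" for n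
    \<comment> \<open>Far out the annulus is zero. Otherwise the copy of \<open>x\<close> lies in
      \<open>U l n\<close>, where \<open>T k f\<close> vanishes unless \<open>k = l\<close>, in
      which case it returns \<open>B n f x = f x\<close>; the subtracted central value is
      \<open>f b = 0\<close> or 0.\<close>
    proof (cases "2 ^ Suc n \<le> dist b x")
      case True
      then show ?thesis using annulus_eq_0_far by fastforce
    next
      case False
      then have "dist b x \<le> 2 ^ Suc n" by simp
      also have "\<dots> \<le> 2 ^ (n + 2)" by simp
      finally have "\<phi> l n x \<in> U l n" "\<phi> l n b \<in> U l n" by (simp_all add: U_iff)
      then show ?thesis
        using False lip0_base[OF f] by (simp add: T_in \<phi>' B_eq[OF f])
    qed
    then have "S l (T k f) x = (\<Sum>n<level b x. annulus b n x) * (if k = l then f x else 0)"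
      unfolding S_def sum_distrib_right by (intro sum.cong refl)
    then show "S l (T k f) x = (if k = l then f else 0) x" by (simp add: sum_annulus_level)
  qed

  have adj: "adjoint_on ?V R m \<in> ?X"
    if "linear_on ?V R" "\<And>f. f \<in> ?V \<Longrightarrow> R f \<in> ?V" "0 \<le> K" "\<And>f. f \<in> ?V \<Longrightarrow> ?N (R f) \<le> K * ?N f"
      "\<And>z. adjoint_on ?V R (delta b UNIV z) \<in> ?X" "m \<in> ?X" for R m K
  proof -
    have "bounded_linear_on ?V ?N ?V ?N R"
      by (rule bounded_linear_onI[where K = K]) (fact that)+
    then show ?thesis
      by (rule adjoint_on_free_space[OF UNIV_I UNIV_I]) (rule that(5), rule that(6))
  qed
  show ?thesis
  proof (rule V.linearly_isomorphic_l1_sum_if_factors[where A = "span (range (delta b UNIV))"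
        and T = T and S = S and K = "6 * C" and L = 9, folded free_space_def])
    show "span (range (delta b UNIV)) \<subseteq> dual_space ?V ?N" by (rule span_delta_subset) simp
    show "adjoint_on ?V (T k) m \<in> ?X" if "m \<in> ?X" for k m
      by (rule adj[where K = "6 * C"]) (use assms(3) in simp | fact T_lin T_mem T_norm T_adj that)+
    show "adjoint_on ?V (S k) m \<in> ?X" if "m \<in> ?X" for k m
      by (rule adj[where K = 9]) (fact S_lin S_mem S_norm S_adj that | simp)+
    show "S l (T k f) = (if k = l then f else 0)" if "f \<in> ?V" for k l f by (rule ST[OF that])
  qed (fact subspace_span T_lin T_mem T_sum S_lin S_mem S_norm)+
qed

end
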